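(* Suppose $\mathbb X$ is unimodular. Then $\mathbf P$-a.s. each connected component $C$ of $G^{\mathfrak H}$ is in one of the three following classes: 1. Class $\mathcal F/\mathcal F$: $C$ is finite, and hence so is each of its $\mathfrak H$-foils. In this case, denoting by $1\le n=n(C)<\infty$ the number of its foils: $C$ has a unique cycle, of length $n$; and $\mathfrak H^\infty(\mathfrak m)\cap C$ is the set of vertices of this cycle. 2. Class $\mathcal I/\mathcal F$: $C$ is infinite and each of its $\mathfrak H$-foils is finite. In this case: $C$ is acyclic; each foil has a junior foil; and $\mathfrak H^\infty(\mathfrak m)\cap C$ is a unique bi-infinite path, i.e. a sequence $\{X_n\}_{n\in\mathbb Z}$ of points of $\mathfrak m$ such that $\mathfrak H(X_n)=X_{n+1}$ for all $n$. 3. Class $\mathcal I/\mathcal I$: $C$ is infinite and all its $\mathfrak H$-foils are infinite. In this case: $C$ is acyclic; and $\mathfrak H^\infty(\mathfrak m)\cap C=\emptyset$.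
   Context: $\mathbb X$ is a locally compact second-countable Hausdorff topological group with Borel sets $\mathcal B(\mathbb X)$ and a fixed left-invariant Haar measure $\lambda$; unimodular means $\lambda$ is also right-invariant. $(\Omega,\mathcal A,\theta,\mathbf P)$ is a stationary framework on $\mathbb X$: $(\Omega,\mathcal A,\mathbf P)$ is a probability space and $\theta:\mathbb X\times\Omega\to\Omega$, $\theta_x\omega:=\theta(x,\omega)$, is a (jointly) measurable left action of $\mathbb X$ preserving $\mathbf P$. $\mathfrak m$ is a simple point process (random locally finite counting measure on $\mathbb X$ with all atoms of mass $1$, identified with its support) that is flow-adapted: $\mathfrak m(\theta_x\omega,B)=\mathfrak m(\omega,x^{-1}B)$ for all $x\in\mathbb X,\omega\in\Omega,B\in\mathcal B(\mathbb X)$; its intensity $\gamma=\mathbf E[\mathfrak m(B)]/\lambda(B)$ (for any $B$ with $\lambda(B)\in(0,\infty)$) lies in $(0,\infty)$. $\mathfrak H$ is a point-shift on $\mathfrak m$: a measurable map $\mathfrak H:\Omega\times\mathbb X\to\mathbb X$ such that for $\mathbf P$-a.e. $\omega$, $\mathfrak H(\omega,X)\in\mathfrak m(\omega)$ for all $X\in\mathfrak m(\omega)$, which is flow-adapted: $\mathfrak H(\theta_y\omega,yx)=y\mathfrak H(\omega,x)$ for all $x,y\in\mathbb X$, $\omega\in\Omega$ (with $\mathfrak H(\omega,x):=x$ for $x\notin\mathfrak m(\omega)$). The dependence on $\omega$ is dropped from the notation. $\mathfrak H^0(X)=X$, $\mathfrak H^{n+1}(X)=\mathfrak H(\mathfrak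 H^n(X))$, and $\mathfrak H^\infty(\mathfrak m)$ is the set of primeval elements: those $Y\in\mathfrak m$ lying in the image set $\mathfrak H^n(\mathfrak m)$ for every $n\in\mathbb N$. $G^{\mathfrak H}$ is the random directed graph with vertex set $\mathfrak m$ and a directed edge from each $X\in\mathfrak m$ to $\mathfrak H(X)$. Connected components are those of the underlying undirected graph: $X,Y\in\mathfrak m$ are in the same component iff $\mathfrak H^m(X)=\mathfrak H^n(Y)$ for some $m,n\ge0$. Cycles are directed cycles (fixed points are cycles of length $1$). The $\mathfrak H$-foils are the equivalence classes of the relation on $\mathfrak m$ in which $X,Y$ are equivalent iff $\mathfrak H^n(X)=\mathfrak H^n(Y)$ for some $n\ge0$; each component is a disjoint union of foils. $L^{\mathfrak H}(X)$ denotes the foil of $X$. A foil $L$ has a junior foil if there is $Y\in\mathfrak m$ with $\mathfrak H(Y)\in L$, in which case the junior foil is $L_-:=L^{\mathfrak H}(Y)$ (independent of the choice of $Y$). *)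

theory Defs
  imports "HOL-Probability.Probability" "Graph_Theory.Digraph_Component"
begin

section \<open>Haar measure and unimodularity\<close>

text \<open>
  The group is written additively because \<^class>\<open>topological_group_add\<close> is the library's class of
  topological groups; its addition is \<^emph>\<open>not\<close> assumed to be commutative. Thus \<open>x + y\<close>, \<open>- x\<close> and \<open>0\<close>
  stand for the product, the inverse and the unit of a possibly non-abelian group.

  For a Borel measure on a locally compact second-countable Hausdorff space, finiteness on compact
  sets already implies regularity, so no regularity clause is needed.
\<close>

definition left_haar_measure :: "'x :: topological_group_add measure \<Rightarrow> bool" where
  "left_haar_measure \<nu> \<longleftrightarrow>
     sets \<nu> = sets borel \<and>
     emeasure \<nu> UNIV \<noteq> 0 \<and>
     (\<forall>K. compact K \<longrightarrow> emeasure \<nu> K < \<infinity>) \<and>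
     (\<forall>x. \<forall>B\<in>sets borel. emeasure \<nu> ((\<lambda>y. x + y) ` B) = emeasure \<nu> B)"

definition right_invariant :: "'x :: topological_group_add measure \<Rightarrow> bool" where
  "right_invariant \<nu> \<longleftrightarrow> (\<forall>x. \<forall>B\<in>sets borel. emeasure \<nu> ((\<lambda>y. y + x) ` B) = emeasure \<nu> B)"


section \<open>Stationary point processes and point-shifts\<close>

locale stationary_framework = prob_space M
  for M :: "'w measure" +
  fixes \<theta> :: "'x :: {topological_group_add, second_countable_topology, t2_space} \<Rightarrow> 'w \<Rightarrow> 'w"
  assumes flow_measurable: "(\<lambda>(x, \<omega>). \<theta> x \<omega>) \<in> borel \<Otimes>\<^sub>M M \<rightarrow>\<^sub>M M"
    and flow_zero: "\<And>\<omega>. \<omega> \<in> space M \<Longrightarrow> \<theta> 0 \<omega> = \<omega>"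
    and flow_add: "\<And>x y \<omega>. \<omega> \<in> space M \<Longrightarrow> \<theta> (x + y) \<omega> = \<theta> x (\<theta> y \<omega>)"
    and flow_preserves: "\<And>x. distr M M (\<theta> x) = M"

definition locally_finite_counting_measure :: "'x :: topological_space measure \<Rightarrow> bool" where
  "locally_finite_counting_measure N \<longleftrightarrow>
     sets N = sets borel \<and>
     (\<forall>K. compact K \<longrightarrow> emeasure N K < \<infinity>) \<and>
     (\<forall>B\<in>sets borel. emeasure N B \<in> insert \<infinity> (range of_nat))"

text \<open>
  For a locally finite counting measure on a locally compact second-countable Hausdorff space, the
  set of atoms is the support.
\<close>
definition atoms :: "'x measure \<Rightarrow> 'x set" where
  "atoms N = {x. emeasure N {x} \<noteq> 0}"

definition simple_measure :: "'x measure \<Rightarrow> bool" where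
  "simple_measure N \<longleftrightarrow> (\<forall>x\<in>atoms N. emeasure N {x} = 1)"

locale flow_adapted_simple_point_process = stationary_framework M \<theta>
  for M :: "'w measure"
    and \<theta> :: "'x :: {topological_group_add, second_countable_topology, t2_space} \<Rightarrow> 'w \<Rightarrow> 'w" +
  fixes \<mm> :: "'w \<Rightarrow> 'x measure"
  assumes process_measurable: "\<And>B. B \<in> sets borel \<Longrightarrow> (\<lambda>\<omega>. emeasure (\<mm> \<omega>) B) \<in> borel_measurable M"
    and process_counting: "\<And>\<omega>. \<omega> \<in> space M \<Longrightarrow> locally_finite_counting_measure (\<mm> \<omega>)"
    and process_simple: "\<And>\<omega>. \<omega> \<in> space M \<Longrightarrow> simple_measure (\<mm> \<omega>)"
    and process_flow: "\<And>x \<omega> B. \<omega> \<in> space M \<Longrightarrow> B \<in> sets borel \<Longrightarrow>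
           emeasure (\<mm> (\<theta> x \<omega>)) B = emeasure (\<mm> \<omega>) ((\<lambda>y. - x + y) ` B)"

definition has_intensity ::
  "'w measure \<Rightarrow> 'x :: topological_space measure \<Rightarrow> ('w \<Rightarrow> 'x measure) \<Rightarrow> ennreal \<Rightarrow> bool" where
  "has_intensity M \<nu> \<mm> \<gamma> \<longleftrightarrow>
     (\<forall>B\<in>sets borel. 0 < emeasure \<nu> B \<and> emeasure \<nu> B < \<infinity> \<longrightarrow>
        (\<integral>\<^sup>+\<omega>. emeasure (\<mm> \<omega>) B \<partial>M) / emeasure \<nu> B = \<gamma>)"

locale point_shift = flow_adapted_simple_point_process M \<theta> \<mm>
  for M :: "'w measure"
    and \<theta> :: "'x :: {topological_group_add, second_countable_topology, t2_space} \<Rightarrow> 'w \<Rightarrow> 'w"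
    and \<mm> :: "'w \<Rightarrow> 'x measure" +
  fixes H :: "'w \<Rightarrow> 'x \<Rightarrow> 'x"
  assumes shift_measurable: "(\<lambda>(\<omega>, x). H \<omega> x) \<in> M \<Otimes>\<^sub>M borel \<rightarrow>\<^sub>M borel"
    and shift_maps: "AE \<omega> in M. \<forall>X\<in>atoms (\<mm> \<omega>). H \<omega> X \<in> atoms (\<mm> \<omega>)"
    and shift_flow: "\<And>\<omega> x y. \<omega> \<in> space M \<Longrightarrow> H (\<theta> y \<omega>) (y + x) = y + H \<omega> x"
    and shift_outside: "\<And>\<omega> x. \<omega> \<in> space M \<Longrightarrow> x \<notin> atoms (\<mm> \<omega>) \<Longrightarrow> H \<omega> x = x"


section \<open>The graph, the foils and the primeval elements of a point-shift\<close>

text \<open>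
  Below, \<open>S\<close> and \<open>h\<close> are one realisation of the support of the point process and of the point-shift.
\<close>

definition shift_graph :: "'x set \<Rightarrow> ('x \<Rightarrow> 'x) \<Rightarrow> ('x, 'x \<times> 'x) pre_digraph" where
  "shift_graph S h = with_proj \<lparr> pverts = S, parcs = {(X, h X) |X. X \<in> S} \<rparr>"

text \<open>
  The components of the underlying undirected graph are the strong components of the symmetric
  closure.
\<close>
definition graph_components :: "('x, 'e) pre_digraph \<Rightarrow> 'x set set" where
  "graph_components G = pre_digraph.sccs_verts (with_proj (mk_symmetric G))"

text \<open>Cycles are lists of arcs, so one geometric cycle is represented by all rotations of a list.\<close>
definition cycle_in :: "('x, 'e) pre_digraph \<Rightarrow> 'x set \<Rightarrow> 'e list \<Rightarrow> bool" where
  "cycle_in G C p \<longleftrightarrow> pre_digraph.cycle G p \<and> tail G ` set p \<subseteq> C"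

definition acyclic_on :: "('x, 'e) pre_digraph \<Rightarrow> 'x set \<Rightarrow> bool" where
  "acyclic_on G C \<longleftrightarrow> (\<nexists>p. cycle_in G C p)"

definition foil_rel :: "'x set \<Rightarrow> ('x \<Rightarrow> 'x) \<Rightarrow> 'x rel" where
  "foil_rel S h = {(X, Y). X \<in> S \<and> Y \<in> S \<and> (\<exists>n. (h ^^ n) X = (h ^^ n) Y)}"

definition foils_in :: "'x set \<Rightarrow> ('x \<Rightarrow> 'x) \<Rightarrow> 'x set \<Rightarrow> 'x set set" where
  "foils_in S h C = {L \<in> S // foil_rel S h. L \<subseteq> C}"

definition has_junior_foil :: "'x set \<Rightarrow> ('x \<Rightarrow> 'x) \<Rightarrow> 'x set \<Rightarrow> bool" where
  "has_junior_foil S h L \<longleftrightarrow> (\<exists>Y\<in>S. h Y \<in> L)"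

definition primeval :: "'x set \<Rightarrow> ('x \<Rightarrow> 'x) \<Rightarrow> 'x set" where
  "primeval S h = {Y \<in> S. \<forall>n. Y \<in> (h ^^ n) ` S}"

definition bi_infinite_path :: "'x set \<Rightarrow> ('x \<Rightarrow> 'x) \<Rightarrow> (int \<Rightarrow> 'x) \<Rightarrow> bool" where
  "bi_infinite_path S h X \<longleftrightarrow> (\<forall>n. X n \<in> S \<and> h (X n) = X (n + 1))"

definition class_FF :: "'x set \<Rightarrow> ('x \<Rightarrow> 'x) \<Rightarrow> 'x set \<Rightarrow> bool" where
  "class_FF S h C \<longleftrightarrow> finite C \<and> (\<forall>L\<in>foils_in S h C. finite L)"

definition class_IF :: "'x set \<Rightarrow> ('x \<Rightarrow> 'x) \<Rightarrow> 'x set \<Rightarrow> bool" where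
  "class_IF S h C \<longleftrightarrow> infinite C \<and> (\<forall>L\<in>foils_in S h C. finite L)"

definition class_II :: "'x set \<Rightarrow> ('x \<Rightarrow> 'x) \<Rightarrow> 'x set \<Rightarrow> bool" where
  "class_II S h C \<longleftrightarrow> infinite C \<and> (\<forall>L\<in>foils_in S h C. infinite L)"

end

theory Submission
  imports Defs
begin

text \<open>
  The probability enters through one identity, the mass transport principle, and everything that
  happens afterwards happens in a single realisation.

  \<^emph>\<open>Mass transport.\<close> Let \<open>f \<omega> x y \<ge> 0\<close> be the mass that the point \<open>x\<close> sends to the point \<open>y\<close>, and
  let \<open>f\<close> be invariant under the joint action of the group. Then the mean mass sent out of a window
  equals the mean mass received in it (\<open>mass_transport\<close>). Since every point can be made to send
  total mass at most \<open>1\<close>, and the mean number of points in a window is finite, almost surely every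
  point receives a finite mass. Letting each \<open>x\<close> spread mass \<open>1\<close> evenly over a finite set selected
  covariantly from \<open>x\<close> gives the workhorse \<open>finitely_many_sources\<close>: almost surely no nonempty finite
  set is the selection of infinitely many points.

  \<^emph>\<open>Consequences.\<close> If each point selects its image, the outcome is that every point has finitely
  many preimages. If each point selects the points of its component with a covariant
  property \<open>Q\<close>, the outcome is that in an infinite component \<open>Q\<close> holds nowhere or infinitely often,
  which is used for "lies in a finite foil whose successor is infinite" and for "lies in a foil
  without junior".
  On primeval points the map is onto, by Koenig's lemma and the finiteness of the
  preimages; the number of primeval preimages of a primeval point is therefore at least \<open>1\<close>, its
  mean is exactly \<open>1\<close> by mass transport, so it is \<open>1\<close> and the map is injective on primeval points
  (\<open>AE_inj_primeval\<close>). Hence a foil has at most one primeval point, and selecting this point shows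
  that its foil is finite (\<open>AE_primeval_foil_finite\<close>).

  \<^emph>\<open>Classification.\<close> The foils of a component form a chain in which finiteness propagates downwards
  because preimages are finite, and upwards because otherwise the last finite foil would be a finite
  selection. Points on cycles are primeval, so their foils are finite, and an infinite component with a
  cycle would be the union of these finitely many foils. If all foils of an infinite component are finite, no foil is the
  lowest one, Koenig's lemma yields primeval points, and bijectivity of the map on them arranges
  them along one bi-infinite path. If all foils are infinite there is no primeval point at all.
  Finite components are elementary.
\<close>

section \<open>Self-maps of a set and the classification of their components\<close>

definition connected_rel :: "'x set \<Rightarrow> ('x \<Rightarrow> 'x) \<Rightarrow> 'x rel" where
  "connected_rel S h = {(X, Y). X \<in> S \<and> Y \<in> S \<and> (\<exists>m n. (h ^^ m) X = (h ^^ n) Y)}"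

text \<open>
  The negation of \<open>has_junior_foil\<close> for the foil of \<open>y\<close>, as a property of points.
\<close>
definition fruitless :: "'x set \<Rightarrow> ('x \<Rightarrow> 'x) \<Rightarrow> 'x \<Rightarrow> bool" where
  "fruitless S h y \<longleftrightarrow> (\<forall>Y\<in>S. (h Y, y) \<notin> foil_rel S h)"

definition last_finite :: "'x set \<Rightarrow> ('x \<Rightarrow> 'x) \<Rightarrow> 'x \<Rightarrow> bool" where
  "last_finite S h y \<longleftrightarrow> finite (foil_rel S h `` {y}) \<and> infinite (foil_rel S h `` {h y})"

text \<open>
  Applied to a property \<open>Q\<close> that can hold only on one finite foil of a component, this excludes
  \<open>Q\<close> from infinite components altogether.
\<close>
definition no_finite_selection :: "'x set \<Rightarrow> ('x \<Rightarrow> 'x) \<Rightarrow> ('x \<Rightarrow> bool) \<Rightarrow> bool" where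
  "no_finite_selection S h Q \<longleftrightarrow>
     (\<forall>x\<in>S. infinite (connected_rel S h `` {x}) \<longrightarrow>
        {y \<in> connected_rel S h `` {x}. Q y} = {} \<or> infinite {y \<in> connected_rel S h `` {x}. Q y})"

locale self_map =
  fixes S :: "'x set" and h :: "'x \<Rightarrow> 'x"
  assumes maps: "x \<in> S \<Longrightarrow> h x \<in> S"
begin

abbreviation "conn \<equiv> connected_rel S h"
abbreviation "foil \<equiv> foil_rel S h"
abbreviation "G \<equiv> shift_graph S h"

lemma funpow_closed [simp, intro]: "x \<in> S \<Longrightarrow> (h ^^ n) x \<in> S"
  by (induction n) (auto intro: maps)

lemma funpow_funpow: "(h ^^ m) ((h ^^ n) x) = (h ^^ (m + n)) x"
  by (simp add: funpow_add)

lemma connI: "x \<in> S \<Longrightarrow> y \<in> S \<Longrightarrow> (h ^^ m) x = (h ^^ n) y \<Longrightarrow> (x, y) \<in> conn"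
  by (auto simp: connected_rel_def)

lemma foilI: "x \<in> S \<Longrightarrow> y \<in> S \<Longrightarrow> (h ^^ n) x = (h ^^ n) y \<Longrightarrow> (x, y) \<in> foil"
  by (auto simp: foil_rel_def)

lemma equiv_conn: "equiv S conn"
proof (rule equivI)
  show "conn \<subseteq> S \<times> S" by (auto simp: connected_rel_def)
  show "refl_on S conn" by (auto simp: refl_on_def connected_rel_def)
  show "sym conn" by (rule symI) (auto simp: connected_rel_def, metis)
  show "trans conn"
  proof (rule transI)
    fix x y z assume "(x, y) \<in> conn" "(y, z) \<in> conn"
    then obtain a b c d where *: "x \<in> S" "z \<in> S" "(h ^^ a) x = (h ^^ b) y" "(h ^^ c) y = (h ^^ d) z"
      by (auto simp: connected_rel_def)
    have "(h ^^ c) ((h ^^ a) x) = (h ^^ b) ((h ^^ d) z)"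
      unfolding *(3) by (simp add: funpow_funpow add.commute flip: *(4))
    then have "(h ^^ (c + a)) x = (h ^^ (b + d)) z" by (simp add: funpow_funpow)
    then show "(x, z) \<in> conn" using * by (auto intro: connI)
  qed
qed

lemma equiv_foil: "equiv S foil"
proof (rule equivI)
  show "foil \<subseteq> S \<times> S" by (auto simp: foil_rel_def)
  show "refl_on S foil" by (auto simp: refl_on_def foil_rel_def)
  show "sym foil" by (rule symI) (auto simp: foil_rel_def, metis)
  show "trans foil"
  proof (rule transI)
    fix x y z assume "(x, y) \<in> foil" "(y, z) \<in> foil"
    then obtain a c where *: "x \<in> S" "z \<in> S" "(h ^^ a) x = (h ^^ a) y" "(h ^^ c) y = (h ^^ c) z"
      by (auto simp: foil_rel_def)
    have "(h ^^ c) ((h ^^ a) x) = (h ^^ a) ((h ^^ c) z)"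
      unfolding *(3) by (simp add: funpow_funpow add.commute flip: *(4))
    then have "(h ^^ (c + a)) x = (h ^^ (c + a)) z" by (simp add: funpow_funpow add.commute)
    then show "(x, z) \<in> foil" using * by (auto intro: foilI)
  qed
qed

lemma foil_subset_conn: "foil \<subseteq> conn"
  by (auto simp: foil_rel_def connected_rel_def)

lemma conn_sym: "(x, y) \<in> conn \<Longrightarrow> (y, x) \<in> conn"
  using equiv_conn by (meson equivE symE)

lemma conn_trans: "(x, y) \<in> conn \<Longrightarrow> (y, z) \<in> conn \<Longrightarrow> (x, z) \<in> conn"
  using equiv_conn by (meson equivE transE)

lemma foil_sym: "(x, y) \<in> foil \<Longrightarrow> (y, x) \<in> foil"
  using equiv_foil by (meson equivE symE)

lemma foil_trans: "(x, y) \<in> foil \<Longrightarrow> (y, z) \<in> foil \<Longrightarrow> (x, z) \<in> foil"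
  using equiv_foil by (meson equivE transE)

lemma foil_h_iff:
  assumes "x \<in> S" "y \<in> S"
  shows "(h x, h y) \<in> foil \<longleftrightarrow> (x, y) \<in> foil"
proof
  assume "(h x, h y) \<in> foil"
  then obtain n where "(h ^^ n) (h x) = (h ^^ n) (h y)" by (auto simp: foil_rel_def)
  then have "(h ^^ Suc n) x = (h ^^ Suc n) y" by (simp add: funpow_swap1)
  then show "(x, y) \<in> foil" using assms by (rule_tac foilI)
next
  assume "(x, y) \<in> foil"
  then obtain n where "(h ^^ n) x = (h ^^ n) y" by (auto simp: foil_rel_def)
  then have "(h ^^ n) (h x) = (h ^^ n) (h y)" by (metis funpow_swap1)
  then show "(h x, h y) \<in> foil" using assms by (auto intro: foilI maps)
qed

lemma foil_funpow_cong: "(x, y) \<in> foil \<Longrightarrow> ((h ^^ n) x, (h ^^ n) y) \<in> foil"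
proof (induction n)
  case (Suc n)
  then show ?case using foil_h_iff[of "(h ^^ n) x" "(h ^^ n) y"] by (auto simp: foil_rel_def)
qed simp

text \<open>
  The foils of a component form a chain under the map, so of two of them one is an iterated
  successor of the other.
\<close>
lemma conn_casesE:
  assumes "(x, y) \<in> conn"
  obtains k where "(x, (h ^^ k) y) \<in> foil" | k where "(y, (h ^^ k) x) \<in> foil"
proof -
  obtain m n where *: "x \<in> S" "y \<in> S" "(h ^^ m) x = (h ^^ n) y"
    using assms by (auto simp: connected_rel_def)
  show thesis
  proof (cases "m \<le> n")
    case True
    then have "(h ^^ m) x = (h ^^ m) ((h ^^ (n - m)) y)"
      using *(3) True by (simp add: funpow_funpow)
    then show thesis using * by (intro that(1)[of "n - m"] foilI[of _ _ m]) auto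
  next
    case False
    then have "(h ^^ n) y = (h ^^ n) ((h ^^ (m - n)) x)"
      using *(3) False by (simp add: funpow_funpow)
    then show thesis using * by (intro that(2)[of "m - n"] foilI[of _ _ n]) auto
  qed
qed

text \<open>
  Every vertex has exactly one outgoing arc, so an undirected path can be replaced by two directed
  paths with a common end.
\<close>
lemma reachable_iff_conn: "reachable (with_proj (mk_symmetric G)) u v \<longleftrightarrow> (u, v) \<in> conn"
proof -
  let ?R = "rtrancl_on S (\<Union>x\<in>S. {(x, h x), (h x, x)})"
  have "arcs_ends (with_proj (mk_symmetric G)) = (\<Union>x\<in>S. {(x, h x), (h x, x)})"
    by (auto simp: shift_graph_def parcs_mk_symmetric with_proj_def arcs_ends_def arc_to_ends_def image_iff)
  moreover have "verts (with_proj (mk_symmetric G)) = S"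
    by (simp add: shift_graph_def with_proj_def)
  ultimately have R: "reachable (with_proj (mk_symmetric G)) u v \<longleftrightarrow> (u, v) \<in> ?R"
    unfolding reachable_def by simp
  have "(u, v) \<in> conn" if "(u, v) \<in> ?R"
    using that
  proof (induction rule: rtrancl_on_induct)
    case base
    then show ?case by (auto intro: connI)
  next
    case (step y z)
    then have "(y, z) \<in> conn"
      by (auto intro: connI[of _ _ 1 0] connI[of _ _ 0 1] maps)
    then show ?case using step conn_trans by blast
  qed
  moreover have "(u, v) \<in> ?R" if "(u, v) \<in> conn"
  proof -
    have up: "(x, (h ^^ n) x) \<in> ?R \<and> ((h ^^ n) x, x) \<in> ?R" if "x \<in> S" for x n
    proof (induction n)
      case (Suc n)
      have "((h ^^ n) x, (h ^^ Suc n) x) \<in> ?R" "((h ^^ Suc n) x, (h ^^ n) x) \<in> ?R"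
        using that funpow_closed[OF that, of n]
        by (auto intro!: rtrancl_on_into_rtrancl_on[OF rtrancl_on_refl] maps)
      then show ?case using Suc by (meson rtrancl_on_trans)
    qed (use that in auto)
    obtain m n where *: "u \<in> S" "v \<in> S" "(h ^^ m) u = (h ^^ n) v"
      using \<open>(u, v) \<in> conn\<close> by (auto simp: connected_rel_def)
    have "(u, (h ^^ m) u) \<in> ?R" "((h ^^ m) u, v) \<in> ?R"
      using up[OF *(1), of m] up[OF *(2), of n] *(3) by auto
    then show ?thesis by (rule rtrancl_on_trans)
  qed
  ultimately show ?thesis using R by blast
qed

lemma component_eq:
  assumes "C \<in> graph_components G" "x \<in> C"
  shows "C = conn `` {x}"
  using assms conn_sym
  unfolding graph_components_def pre_digraph.sccs_verts_def reachable_iff_conn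
  by blast

lemma component_nonempty: "C \<in> graph_components G \<Longrightarrow> C \<noteq> {}"
  by (auto simp: graph_components_def pre_digraph.sccs_verts_def)

lemma foils_in_conn:
  assumes "x \<in> S"
  shows "foils_in S h (conn `` {x}) = (\<lambda>y. foil `` {y}) ` (conn `` {x})"
proof (intro equalityI subsetI)
  fix L assume "L \<in> foils_in S h (conn `` {x})"
  then obtain y where "y \<in> S" "L = foil `` {y}" "L \<subseteq> conn `` {x}"
    by (auto simp: foils_in_def elim: quotientE)
  then show "L \<in> (\<lambda>y. foil `` {y}) ` (conn `` {x})"
    using equiv_class_self[OF equiv_foil] by blast
next
  fix L assume "L \<in> (\<lambda>y. foil `` {y}) ` (conn `` {x})"
  then obtain y where y: "(x, y) \<in> conn" "L = foil `` {y}" by auto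
  then have "y \<in> S" by (auto simp: connected_rel_def)
  then show "L \<in> foils_in S h (conn `` {x})"
    using y foil_subset_conn conn_trans by (auto simp: foils_in_def intro!: quotientI)
qed

subsection \<open>Cycles\<close>

definition periodic :: "'x \<Rightarrow> bool" where
  "periodic y \<longleftrightarrow> y \<in> S \<and> (\<exists>k>0. (h ^^ k) y = y)"

definition orbit_walk :: "'x \<Rightarrow> nat \<Rightarrow> ('x \<times> 'x) list" where
  "orbit_walk y k = map (\<lambda>i. ((h ^^ i) y, (h ^^ Suc i) y)) [0..<k]"

lemma length_orbit_walk [simp]: "length (orbit_walk y k) = k"
  by (simp add: orbit_walk_def)

lemma orbit_walk_Suc: "orbit_walk y (Suc k) = (y, h y) # orbit_walk (h y) k"
  unfolding orbit_walk_def by (subst upt_conv_Cons) (auto simp: map_Suc_upt[symmetric] funpow_swap1 simp del: upt_Suc)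

lemma awalk_iff: "pre_digraph.awalk G u p v \<longleftrightarrow> u \<in> S \<and> p = orbit_walk u (length p) \<and> v = (h ^^ length p) u"
proof (induction p arbitrary: u)
  case Nil
  then show ?case
    by (auto simp: pre_digraph.awalk_def pre_digraph.cas.simps shift_graph_def with_proj_def orbit_walk_def)
next
  case (Cons e p)
  have "pre_digraph.awalk G u (e # p) v \<longleftrightarrow> u \<in> S \<and> e = (u, h u) \<and> pre_digraph.awalk G (h u) p v"
    by (auto simp: pre_digraph.awalk_def pre_digraph.cas.simps shift_graph_def with_proj_def maps)
  then show ?case
    unfolding Cons.IH by (auto simp: orbit_walk_Suc funpow_swap1 maps)
qed

lemma awalk_verts_orbit_walk:
  "pre_digraph.awalk_verts G u (orbit_walk u k) = map (\<lambda>i. (h ^^ i) u) [0..<Suc k]"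
proof (induction k arbitrary: u)
  case 0
  then show ?case by (simp add: orbit_walk_def pre_digraph.awalk_verts.simps)
next
  case (Suc k)
  have "tail G = fst" "head G = snd" by (simp_all add: shift_graph_def with_proj_def)
  then show ?case
    unfolding orbit_walk_Suc pre_digraph.awalk_verts.simps
    by (subst upt_conv_Cons)
      (auto simp: map_Suc_upt[symmetric] funpow_swap1 Suc simp del: upt_Suc)
qed

lemma tail_orbit_walk: "tail G ` set (orbit_walk u k) = (\<lambda>i. (h ^^ i) u) ` {..<k}"
  by (auto simp: orbit_walk_def shift_graph_def with_proj_def image_image)

text \<open>
  As the start of a walk determines its arcs, a cycle is the orbit of a point up to a return time
  before which no point repeats.
\<close>
lemma cycle_iff:
  "pre_digraph.cycle G p \<longleftrightarrow> (\<exists>u\<in>S. p \<noteq> [] \<and> p = orbit_walk u (length p) \<and>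
     (h ^^ length p) u = u \<and> inj_on (\<lambda>i. (h ^^ i) u) {1..length p})"
proof -
  have "distinct (tl (pre_digraph.awalk_verts G u (orbit_walk u (length p)))) \<longleftrightarrow> inj_on (\<lambda>i. (h ^^ i) u) {1..length p}" for u
    unfolding awalk_verts_orbit_walk
    by (subst upt_conv_Cons) (auto simp: distinct_map atLeastLessThanSuc_atLeastAtMost simp del: upt_Suc)
  then show ?thesis
    unfolding pre_digraph.cycle_def awalk_iff by (auto simp: Bex_def) metis+
qed

lemma funpow_period: "(h ^^ k) y = y \<Longrightarrow> (h ^^ (k * n + i)) y = (h ^^ i) y"
  using funpow_mod_eq[of k h y "k * n + i"] funpow_mod_eq[of k h y i] by simp

lemma periodic_funpow: "periodic y \<Longrightarrow> periodic ((h ^^ n) y)"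
proof -
  assume "periodic y"
  then obtain k where k: "k > 0" "(h ^^ k) y = y" "y \<in> S" by (auto simp: periodic_def)
  then have "(h ^^ k) ((h ^^ n) y) = (h ^^ n) y"
    using funpow_period[OF k(2), of 1 n] by (simp add: funpow_funpow)
  then show ?thesis using k unfolding periodic_def by blast
qed

lemma periodic_primeval:
  assumes "periodic y" shows "y \<in> primeval S h"
proof -
  obtain k where k: "k > 0" "(h ^^ k) y = y" "y \<in> S" using assms by (auto simp: periodic_def)
  have "y = (h ^^ n) ((h ^^ (k * n - n)) y)" for n
  proof -
    have "n + (k * n - n) = k * n" using k(1) by simp
    then show ?thesis using funpow_period[OF k(2), of n 0] by (simp add: funpow_funpow)
  qed
  then show ?thesis using k(3) unfolding primeval_def by blast
qed

text \<open>
  Both points eventually follow the cycle; \<open>j\<close> is the position on the cycle at which an orbit has to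
  start to be synchronised with that of \<open>x\<close>.
\<close>
lemma conn_periodic_foil:
  assumes "(h ^^ k) y = y" "k > 0" "(x, y) \<in> conn"
  obtains j where "j < k" "(x, (h ^^ j) y) \<in> foil"
proof -
  obtain m n where *: "x \<in> S" "y \<in> S" "(h ^^ m) x = (h ^^ n) y"
    using assms by (auto simp: connected_rel_def)
  \<comment> \<open>adding the multiple \<open>k * m\<close> of the period makes \<open>n - m\<close> nonnegative\<close>
  define j where "j = n + (k * m - m)"
  have "m \<le> k * m" using assms(2) by simp
  then have "m + j = k * m + n" unfolding j_def by linarith
  then have "(h ^^ m) ((h ^^ j) y) = (h ^^ m) x"
    using funpow_period[OF assms(1), of m n] * by (simp add: funpow_funpow)
  then have "(x, (h ^^ j) y) \<in> foil" using * by (metis foilI funpow_closed)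
  then show thesis using assms(2) funpow_mod_eq[OF assms(1)] that[of "j mod k"] by simp
qed

text \<open>
  Two periodic points whose orbits merge can be moved on by a common multiple of their
  periods without changing, so they already coincide.
\<close>
lemma foil_periodic_eq:
  assumes "periodic y" "periodic z" "(y, z) \<in> foil"
  shows "y = z"
proof -
  obtain k l where *: "k > 0" "(h ^^ k) y = y" "l > 0" "(h ^^ l) z = z"
    using assms by (auto simp: periodic_def)
  obtain n where n: "(h ^^ n) y = (h ^^ n) z" using assms(3) by (auto simp: foil_rel_def)
  have eq: "(k * l * n - n) + n = k * (l * n)" "(k * l * n - n) + n = l * (k * n)"
    using * by simp_all
  have "y = (h ^^ ((k * l * n - n) + n)) y" unfolding eq(1) using funpow_period[OF *(2), of "l*n" 0] by simp
  also have "\<dots> = (h ^^ ((k * l * n - n) + n)) z" using n by (simp add: funpow_add)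
  also have "\<dots> = z" unfolding eq(2) using funpow_period[OF *(4), of "k*n" 0] by simp
  finally show ?thesis .
qed

lemma least_periodE:
  assumes "periodic y"
  obtains k where "k > 0" "(h ^^ k) y = y" "inj_on (\<lambda>i. (h ^^ i) y) {..<k}"
proof -
  define k where "k = (LEAST k. k > 0 \<and> (h ^^ k) y = y)"
  have k: "k > 0 \<and> (h ^^ k) y = y"
    unfolding k_def by (rule LeastI_ex) (use assms in \<open>auto simp: periodic_def\<close>)
  have least: "\<not> (h ^^ j) y = y" if "0 < j" "j < k" for j
    using that not_less_Least unfolding k_def by blast
  have "i = j" if "i \<le> j" "j < k" "(h ^^ i) y = (h ^^ j) y" for i j
  proof (rule ccontr)
    assume "i \<noteq> j"
    have "(h ^^ (k - i + i)) y = (h ^^ (k - i + j)) y"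
      using that(3) by (simp add: funpow_add)
    also have "k - i + i = k" using that by simp
    also have "k - i + j = (j - i) + k" using that by simp
    finally have "(h ^^ (j - i)) y = y" using k by (simp add: funpow_add)
    then show False using least[of "j - i"] that \<open>i \<noteq> j\<close> by simp
  qed
  then have "inj_on (\<lambda>i. (h ^^ i) y) {..<k}"
    by (intro inj_onI) (metis lessThan_iff nat_le_linear)
  then show thesis using that k by blast
qed

lemma cycle_periodic:
  assumes "cycle_in G C p"
  obtains u where "u \<in> C" "periodic u" "p = orbit_walk u (length p)" "(h ^^ length p) u = u"
      "inj_on (\<lambda>i. (h ^^ i) u) {1..length p}" "p \<noteq> []"
proof -
  obtain u where u: "u \<in> S" "p \<noteq> []" "p = orbit_walk u (length p)"
     "(h ^^ length p) u = u" "inj_on (\<lambda>i. (h ^^ i) u) {1..length p}"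
    using assms unfolding cycle_in_def cycle_iff by blast
  have "u \<in> tail G ` set p"
    using u(2) by (subst u(3), subst tail_orbit_walk) (auto intro!: image_eqI[of _ _ 0])
  then have "u \<in> C" using assms by (auto simp: cycle_in_def)
  then show thesis using that u unfolding periodic_def by blast
qed

text \<open>
  By the pigeonhole principle every orbit enters a cycle within \<open>card C\<close> steps. All periodic points
  of the component lie on one cycle by \<open>conn_periodic_foil\<close> and \<open>foil_periodic_eq\<close>, and the foils are
  represented by its points.
\<close>
lemma finite_component_cycle:
  assumes "x \<in> S" "finite (conn `` {x})"
  defines "C \<equiv> conn `` {x}"
  shows "finite (foils_in S h C) \<and> 1 \<le> card (foils_in S h C) \<and>
        (\<exists>p. cycle_in G C p \<and> (\<forall>q. cycle_in G C q \<longrightarrow> (\<exists>k. q = rotate k p)) \<and>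
             length p = card (foils_in S h C) \<and>
             primeval S h \<inter> C = tail G ` set p)"
proof -
  have inC: "(h ^^ n) z \<in> C" if "z \<in> C" for z n
  proof -
    have "(z, (h ^^ n) z) \<in> conn"
      using that by (intro connI[of _ _ n 0]) (auto simp: C_def connected_rel_def)
    then show ?thesis using that unfolding C_def using conn_trans by blast
  qed
  have CS: "C \<subseteq> S" by (auto simp: C_def connected_rel_def)
  have xC: "x \<in> C" using assms(1) equiv_class_self[OF equiv_conn] by (auto simp: C_def)
  have CC: "(a, b) \<in> conn" if "a \<in> C" "b \<in> C" for a b
    using that conn_sym conn_trans unfolding C_def by blast
  have eventually_periodic: "periodic ((h ^^ n) z)" if "z \<in> C" "card C \<le> n" for z n
  proof -
    have "\<not> inj_on (\<lambda>i. (h ^^ i) z) {..n}"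
    proof
      assume "inj_on (\<lambda>i. (h ^^ i) z) {..n}"
      then have "card {..n} \<le> card C"
        by (rule card_inj_on_le) (use inC[OF that(1)] assms(2) in \<open>auto simp: C_def\<close>)
      then show False using that(2) by simp
    qed
    then obtain i j where ij: "i < j" "j \<le> n" "(h ^^ i) z = (h ^^ j) z"
      unfolding inj_on_def by (metis atMost_iff linorder_neqE_nat)
    have "(h ^^ (j - i)) ((h ^^ i) z) = (h ^^ i) z"
      using ij(1) ij(3)[symmetric] by (simp add: funpow_funpow)
    then have "periodic ((h ^^ i) z)"
      using ij inC[OF that(1)] CS unfolding periodic_def by (metis subsetD zero_less_diff)
    then have "periodic ((h ^^ (n - i)) ((h ^^ i) z))" by (rule periodic_funpow)
    then show ?thesis using ij(1,2) by (simp add: funpow_funpow)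
  qed
  define y where "y = (h ^^ card C) x"
  have y: "periodic y" "y \<in> C" "y \<in> S"
    using eventually_periodic[OF xC] inC[OF xC] CS by (auto simp: y_def)
  obtain k where k: "k > 0" "(h ^^ k) y = y" "inj_on (\<lambda>i. (h ^^ i) y) {..<k}"
    using least_periodE[OF y(1)] .
  define p where "p = orbit_walk y k"
  have orbit: "\<exists>j<k. z = (h ^^ j) y" if "z \<in> C" "periodic z" for z
    using conn_periodic_foil[OF k(2,1) CC[OF that(1) y(2)]] foil_periodic_eq[OF that(2) periodic_funpow[OF y(1)]]
    by metis
  have foils: "foils_in S h C = (\<lambda>j. foil `` {(h ^^ j) y}) ` {..<k}"
  proof -
    have "foil `` {z} \<in> (\<lambda>j. foil `` {(h ^^ j) y}) ` {..<k}" if "z \<in> C" for z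
      using conn_periodic_foil[OF k(2,1) CC[OF that y(2)]] equiv_class_eq[OF equiv_foil]
      by (metis (mono_tags, lifting) image_eqI lessThan_iff)
    then show ?thesis
      unfolding C_def foils_in_conn[OF assms(1)]
      using inC[OF y(2)] unfolding C_def by fastforce
  qed
  have "inj_on (\<lambda>j. foil `` {(h ^^ j) y}) {..<k}"
  proof (rule inj_onI)
    fix i j assume ij: "i \<in> {..<k}" "j \<in> {..<k}" "foil `` {(h ^^ i) y} = foil `` {(h ^^ j) y}"
    then have "((h ^^ i) y, (h ^^ j) y) \<in> foil"
      using eq_equiv_class[OF _ equiv_foil] funpow_closed[OF y(3)] by blast
    then have "(h ^^ i) y = (h ^^ j) y"
      by (intro foil_periodic_eq periodic_funpow y)
    then show "i = j" using k(3) ij by (auto dest: inj_onD)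
  qed
  then have card: "card (foils_in S h C) = k" unfolding foils by (simp add: card_image)
  have inj1: "inj_on (\<lambda>i. (h ^^ i) y) {1..k}"
  proof (rule inj_onI)
    fix i j assume ij: "i \<in> {1..k}" "j \<in> {1..k}" "(h ^^ i) y = (h ^^ j) y"
    have "(h ^^ (i mod k)) y = (h ^^ (j mod k)) y" using ij(3) funpow_mod_eq[OF k(2)] by simp
    then have "i mod k = j mod k" using k(1,3) by (auto dest: inj_onD)
    then show "i = j" using ij(1,2) by (cases "i = k"; cases "j = k") auto
  qed
  have prim: "primeval S h \<inter> C = tail G ` set p"
  proof (intro equalityI subsetI)
    fix z assume z: "z \<in> primeval S h \<inter> C"
    then obtain w where w: "w \<in> S" "z = (h ^^ card C) w" unfolding primeval_def by blast
    then have "(z, w) \<in> conn" using z CS by (intro connI[of _ _ 0 "card C"]) auto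
    then have "w \<in> C" using z conn_trans unfolding C_def by blast
    then have "periodic z" using w eventually_periodic by simp
    then show "z \<in> tail G ` set p" using orbit z unfolding p_def tail_orbit_walk by blast
  next
    fix z assume "z \<in> tail G ` set p"
    then show "z \<in> primeval S h \<inter> C"
      unfolding p_def tail_orbit_walk using inC[OF y(2)] periodic_primeval periodic_funpow y(1) by blast
  qed
  have cyc: "cycle_in G C p"
    unfolding cycle_in_def cycle_iff using k y inj1 prim
    by (auto simp: p_def orbit_walk_def intro!: bexI[of _ y])
  have "\<exists>j. q = rotate j p" if q: "cycle_in G C q" for q
  proof -
    obtain u where u: "u \<in> C" "periodic u" "q = orbit_walk u (length q)" "(h ^^ length q) u = u"
      "inj_on (\<lambda>i. (h ^^ i) u) {1..length q}" "q \<noteq> []"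
      using cycle_periodic[OF q] .
    obtain j where j: "j < k" "u = (h ^^ j) y" using orbit[OF u(1,2)] by blast
    have ku: "(h ^^ k) u = u" unfolding j using funpow_period[OF k(2), of 1 j] by (simp add: funpow_funpow)
    have "length q = k"
    proof (rule antisym; rule ccontr)
      assume "\<not> length q \<le> k"
      then have "(h ^^ k) u = (h ^^ length q) u \<and> k \<in> {1..length q} \<and> length q \<in> {1..length q}"
        using ku u(4) k(1) by simp
      then show False using u(5) \<open>\<not> length q \<le> k\<close> by (metis inj_onD order_refl)
    next
      assume less: "\<not> k \<le> length q"
      obtain i where "y = (h ^^ i) u"
      proof -
        have "y = (h ^^ (k - j + j)) y" using k(2) j(1) by simp
        then have "y = (h ^^ (k - j)) u" using j(2) by (simp add: funpow_add)
        then show thesis using that by blast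
      qed
      then have "(h ^^ length q) y = (h ^^ i) ((h ^^ length q) u)" by (simp add: funpow_funpow add.commute)
      then have "(h ^^ length q) y = y" using u(4) \<open>y = (h ^^ i) u\<close> by simp
      then show False using inj_onD[OF k(3), of "length q" 0] less u(6) k(1) by simp
    qed
    moreover have "orbit_walk u k = rotate j p"
    proof (rule nth_equalityI)
      fix i assume "i < length (orbit_walk u k)"
      then have "i < k" by simp
      have "(h ^^ i) u = (h ^^ ((j + i) mod k)) y"
        unfolding j(2) funpow_mod_eq[OF k(2)] by (simp add: funpow_funpow add.commute)
      then show "orbit_walk u k ! i = rotate j p ! i"
        using \<open>i < k\<close> k(1) by (simp add: nth_rotate p_def orbit_walk_def)
    qed (simp add: p_def)
    ultimately show ?thesis using u(3) by metis
  qed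
  then show ?thesis using cyc card prim k(1) foils by (auto simp: p_def)
qed

text \<open>
  A cycle consists of primeval points, and their foils cover the component.
\<close>
lemma infinite_component_acyclic:
  assumes "x \<in> S" "infinite (conn `` {x})"
    and "\<And>y. y \<in> primeval S h \<Longrightarrow> finite (foil `` {y})"
  shows "acyclic_on G (conn `` {x})"
  unfolding acyclic_on_def
proof
  assume "\<exists>p. cycle_in G (conn `` {x}) p"
  then obtain p where p: "cycle_in G (conn `` {x}) p" by blast
  obtain u where u: "(x, u) \<in> conn" "periodic u" by (rule cycle_periodic[OF p]) blast
  obtain k where k: "k > 0" "(h ^^ k) u = u" using u(2) by (auto simp: periodic_def)
  have "conn `` {x} \<subseteq> (\<Union>j<k. foil `` {(h ^^ j) u})"
  proof
    fix z assume "z \<in> conn `` {x}"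
    then have "(z, u) \<in> conn" using u(1) conn_trans conn_sym by blast
    then show "z \<in> (\<Union>j<k. foil `` {(h ^^ j) u})"
      using conn_periodic_foil[OF k(2,1)] foil_sym by (metis Image_singleton_iff UN_iff lessThan_iff)
  qed
  moreover have "finite (\<Union>j<k. foil `` {(h ^^ j) u})"
    using assms(3) periodic_primeval periodic_funpow u(2) by blast
  ultimately show False using assms(2) finite_subset by blast
qed

subsection \<open>Infinite components\<close>

text \<open>
  A foil is the full preimage of the foil that it is mapped into.
\<close>
lemma infinite_foil_h:
  assumes "\<And>y. y \<in> S \<Longrightarrow> finite {x \<in> S. h x = y}" and "x \<in> S" "finite (foil `` {h x})"
  shows "finite (foil `` {x})"
proof -
  have "foil `` {x} \<subseteq> (\<Union>y\<in>foil `` {h x}. {z \<in> S. h z = y})"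
    using assms(2) foil_h_iff by (auto simp: foil_rel_def intro: maps)
  moreover have "finite (\<Union>y\<in>foil `` {h x}. {z \<in> S. h z = y})"
    using assms(1,3) by (auto simp: foil_rel_def)
  ultimately show ?thesis by (rule finite_subset)
qed

text \<open>
  If no foil on which \<open>Q\<close> occurs is an iterated successor of another one, then \<open>Q\<close> occurs on at most
  one foil of the component; a finite foil would then make \<open>Q\<close> a finite selection.
\<close>
lemma single_foil_finite:
  assumes sel: "no_finite_selection S h Q"
    and x: "x \<in> S" "infinite (conn `` {x})"
    and fin: "\<And>y. y \<in> S \<Longrightarrow> (x, y) \<in> conn \<Longrightarrow> Q y \<Longrightarrow> finite (foil `` {y})"
    and senior: "\<And>y z n. y \<in> S \<Longrightarrow> Q y \<Longrightarrow> (x, y) \<in> conn \<Longrightarrow> z \<in> S \<Longrightarrow> Q z \<Longrightarrow> (y, (h ^^ Suc n) z) \<notin> foil"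
  shows "\<forall>y. (x, y) \<in> conn \<longrightarrow> \<not> Q y"
proof (intro allI impI notI)
  fix y assume y: "(x, y) \<in> conn" "Q y"
  have xS: "z \<in> S" if "(x, z) \<in> conn" for z using that by (auto simp: connected_rel_def)
  have "z \<in> foil `` {y}" if z: "(x, z) \<in> conn" "Q z" for z
  proof -
    have "(y, z) \<in> conn" using y(1) z(1) conn_sym conn_trans by blast
    then show ?thesis
    proof (cases rule: conn_casesE)
      case (1 k)
      then show ?thesis using senior[OF xS[OF y(1)] y(2,1) xS[OF z(1)] z(2)] by (cases k) auto
    next
      case (2 k)
      then show ?thesis using senior[OF xS[OF z(1)] z(2,1) xS[OF y(1)] y(2)] foil_sym by (cases k) auto
    qed
  qed
  then have "{z \<in> conn `` {x}. Q z} \<subseteq> foil `` {y}" by auto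
  then have "finite {z \<in> conn `` {x}. Q z}"
    using fin[OF xS[OF y(1)] y] finite_subset by blast
  moreover have "y \<in> {z \<in> conn `` {x}. Q z}" using y by auto
  ultimately show False using sel x unfolding no_finite_selection_def by blast
qed

text \<open>
  Infinite foils have infinite successors because fibres are finite. A component with foils of
  both kinds would therefore have exactly one finite foil followed by an infinite one.
\<close>
lemma foils_all_finite_or_all_infinite:
  assumes fibres: "\<And>y. y \<in> S \<Longrightarrow> finite {x \<in> S. h x = y}"
    and sel: "no_finite_selection S h (last_finite S h)"
    and x: "x \<in> S" "infinite (conn `` {x})"
    and y: "(x, y) \<in> conn" "finite (foil `` {y})" and z: "(x, z) \<in> conn"
  shows "finite (foil `` {z})"
proof (rule ccontr)
  assume inf: "infinite (foil `` {z})"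
  have up: "infinite (foil `` {(h ^^ n) w})" if "w \<in> S" "infinite (foil `` {w})" for w n
    using that(2) by (induction n) (use infinite_foil_h[OF fibres] that(1) in auto)
  have none: "\<forall>w. (x, w) \<in> conn \<longrightarrow> \<not> last_finite S h w"
  proof (rule single_foil_finite[OF sel x])
    fix u v n assume *: "u \<in> S" "last_finite S h u" "v \<in> S" "last_finite S h v"
    show "(u, (h ^^ Suc n) v) \<notin> foil"
    proof
      assume "(u, (h ^^ Suc n) v) \<in> foil"
      then have "foil `` {u} = foil `` {(h ^^ n) (h v)}"
        using equiv_class_eq[OF equiv_foil] by (metis funpow_Suc_right o_apply)
      then show False using up[of "h v" n] * by (auto simp: last_finite_def maps)
    qed
  qed (auto simp: last_finite_def)
  have S: "y \<in> S" "z \<in> S" using y z by (auto simp: connected_rel_def)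
  have "(y, z) \<in> conn" using y z conn_sym conn_trans by blast
  then obtain m n where mn: "(h ^^ m) y = (h ^^ n) z" by (auto simp: connected_rel_def)
  have "finite (foil `` {(h ^^ i) y})" for i
  proof (induction i)
    case (Suc i)
    have "(y, (h ^^ i) y) \<in> conn" using S by (intro connI[of _ _ i 0]) auto
    then have "(x, (h ^^ i) y) \<in> conn" using y(1) conn_trans by blast
    then show ?case using none Suc by (auto simp: last_finite_def)
  qed (use y in simp)
  then show False using up[OF S(2) inf, of n] mn by metis
qed

text \<open>
  A foil without junior is the lowest one of its component, hence unique there.
\<close>
lemma junior_foils:
  assumes sel: "no_finite_selection S h (fruitless S h)"
    and x: "x \<in> S" "infinite (conn `` {x})"
    and fin: "\<And>y. (x, y) \<in> conn \<Longrightarrow> finite (foil `` {y})"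
    and y: "(x, y) \<in> conn"
  shows "\<exists>z\<in>S. (h z, y) \<in> foil"
proof -
  have "\<forall>w. (x, w) \<in> conn \<longrightarrow> \<not> fruitless S h w"
  proof (rule single_foil_finite[OF sel x])
    fix u v n assume *: "u \<in> S" "fruitless S h u" "v \<in> S" "fruitless S h v"
    then show "(u, (h ^^ Suc n) v) \<notin> foil"
      using foil_sym unfolding fruitless_def by (metis comp_apply funpow.simps(2) funpow_closed)
  qed (use fin in auto)
  then show ?thesis using y unfolding fruitless_def by blast
qed

lemma primeval_closed:
  assumes "y \<in> primeval S h" shows "h y \<in> primeval S h"
proof -
  have "h y \<in> (h ^^ n) ` S" for n
  proof -
    obtain w where "w \<in> S" "y = (h ^^ n) w" using assms by (auto simp: primeval_def)
    then show ?thesis by (intro image_eqI[of _ _ "h w"]) (auto simp: funpow_swap1 maps)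
  qed
  then show ?thesis using assms by (auto simp: primeval_def maps)
qed

lemma primeval_funpow: "y \<in> primeval S h \<Longrightarrow> (h ^^ n) y \<in> primeval S h"
  by (induction n) (auto intro: primeval_closed)

lemma inj_on_funpow_primeval:
  assumes "inj_on h (primeval S h)" "q \<in> primeval S h" "r \<in> primeval S h" "(h ^^ n) q = (h ^^ n) r"
  shows "q = r"
  using assms(4)
proof (induction n)
  case (Suc n)
  then show ?case using assms(1-3) primeval_funpow by (auto dest: inj_onD)
qed simp

lemma primeval_foil_unique:
  assumes "inj_on h (primeval S h)" "q \<in> primeval S h" "r \<in> primeval S h" "(q, r) \<in> foil"
  shows "q = r"
  using assms inj_on_funpow_primeval by (auto simp: foil_rel_def)

lemma decreasing_images: "m \<le> n \<Longrightarrow> (h ^^ n) ` S \<subseteq> (h ^^ m) ` S"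
proof
  fix y assume mn: "m \<le> n" and "y \<in> (h ^^ n) ` S"
  then obtain w where "w \<in> S" "y = (h ^^ m) ((h ^^ (n - m)) w)"
    by (metis (no_types, opaque_lifting) comp_apply funpow_add imageE le_add_diff_inverse)
  then show "y \<in> (h ^^ m) ` S" by auto
qed

text \<open>
  Koenig's lemma for the decreasing sequence of the image sets.
\<close>
lemma primeval_in_finite:
  assumes "finite A" "A \<subseteq> S" "\<And>n. \<exists>y\<in>A. y \<in> (h ^^ n) ` S"
  shows "\<exists>y\<in>A. y \<in> primeval S h"
proof -
  obtain f where f: "\<And>n. f n \<in> A" "\<And>n. f n \<in> (h ^^ n) ` S" using assms(3) by metis
  obtain n0 where "infinite {n. f n = f n0}"
    using pigeonhole_infinite[of UNIV f] f(1) assms(1)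
    by (auto simp: finite_subset[OF _ assms(1)] image_subset_iff)
  then have "f n0 \<in> (h ^^ m) ` S" for m
    using f(2) decreasing_images by (metis (mono_tags, lifting) infinite_nat_iff_unbounded_le mem_Collect_eq subsetD)
  then show ?thesis using f(1) assms(2) by (auto simp: primeval_def)
qed

text \<open>
  One of the finitely many preimages of a primeval point has to lie in infinitely many, hence in all,
  of the image sets.
\<close>
lemma primeval_surj:
  assumes fibres: "\<And>y. y \<in> S \<Longrightarrow> finite {x \<in> S. h x = y}" and y: "y \<in> primeval S h"
  shows "\<exists>x\<in>primeval S h. h x = y"
proof -
  have "y \<in> S" using y by (simp add: primeval_def)
  have "\<exists>x\<in>{x \<in> S. h x = y}. x \<in> (h ^^ n) ` S" for n
  proof -
    have "y \<in> (h ^^ Suc n) ` S" using y unfolding primeval_def by blast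
    then show ?thesis by (auto intro!: bexI)
  qed
  then have "\<exists>x\<in>{x \<in> S. h x = y}. x \<in> primeval S h"
    by (intro primeval_in_finite fibres \<open>y \<in> S\<close>) auto
  then show ?thesis by blast
qed

lemma bi_infinite_path_funpow:
  assumes "bi_infinite_path S h X" shows "(h ^^ k) (X n) = X (n + int k)"
  by (induction k) (use assms in \<open>auto simp: bi_infinite_path_def algebra_simps\<close>)

lemma bi_infinite_path_primeval:
  assumes "bi_infinite_path S h X" shows "X n \<in> primeval S h"
proof -
  have "X n = (h ^^ k) (X (n - int k))" for k
    using bi_infinite_path_funpow[OF assms, of k "n - int k"] by simp
  then show ?thesis using assms by (auto simp: primeval_def bi_infinite_path_def)
qed

text \<open>
  The map is a bijection on primeval points, so forward iteration and iteration of the inverse \<open>g\<close>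
  give a path through \<open>p\<close>. Any two primeval points of a component have a common iterate, and
  injectivity turns this into one being an iterate of the other.
\<close>
lemma unique_path:
  assumes fibres: "\<And>y. y \<in> S \<Longrightarrow> finite {x \<in> S. h x = y}"
    and inj: "inj_on h (primeval S h)"
    and p: "p \<in> primeval S h" "(x, p) \<in> conn"
  shows "\<exists>X. bi_infinite_path S h X \<and> range X = primeval S h \<inter> conn `` {x} \<and>
    (\<forall>Y. bi_infinite_path S h Y \<and> range Y \<subseteq> conn `` {x} \<longrightarrow> (\<exists>k. \<forall>n. Y n = X (n + k)))"
proof -
  let ?P = "primeval S h"
  have PS: "?P \<subseteq> S" by (auto simp: primeval_def)
  obtain g where g: "\<And>y. y \<in> ?P \<Longrightarrow> g y \<in> ?P" "\<And>y. y \<in> ?P \<Longrightarrow> h (g y) = y"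
    using primeval_surj[OF fibres] by metis
  have gP: "(g ^^ n) p \<in> ?P" for n by (induction n) (use p g in auto)
  note inj_pow = inj_on_funpow_primeval[OF inj]
  define X where "X n = (if n \<ge> 0 then (h ^^ nat n) p else (g ^^ nat (- n)) p)" for n :: int
  have XP: "X n \<in> ?P" for n using gP primeval_funpow p by (auto simp: X_def)
  have step: "h (X n) = X (n + 1)" for n
  proof (cases "n \<ge> 0")
    case True
    then have "nat (n + 1) = Suc (nat n)" by simp
    then show ?thesis using True by (simp add: X_def)
  next
    case False
    then obtain k where k: "nat (- n) = Suc k" by (metis gr0_implies_Suc neg_0_less_iff_less not_le zero_less_nat_eq)
    then have "h (X n) = (g ^^ k) p" using False g(2)[OF gP[of k]] by (simp add: X_def)
    moreover have "X (n + 1) = (g ^^ k) p"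
    proof (cases "n = -1")
      case True
      then show ?thesis using k by (simp add: X_def)
    next
      case F: False
      then have "nat (- (n + 1)) = k" using k by simp
      then show ?thesis using F False by (simp add: X_def)
    qed
    ultimately show ?thesis by simp
  qed
  have path: "bi_infinite_path S h X" using XP PS step by (auto simp: bi_infinite_path_def)
  have "X n \<in> conn `` {x}" for n
  proof -
    have "(p, X n) \<in> conn"
    proof (cases "n \<ge> 0")
      case True
      then show ?thesis using p XP PS by (intro connI[of _ _ "nat n" 0]) (auto simp: X_def)
    next
      case False
      then have "(h ^^ nat (-n)) (X n) = p"
        using bi_infinite_path_funpow[OF path, of "nat (-n)" n] by (simp add: X_def)
      then show ?thesis using p XP PS by (intro connI[of _ _ 0 "nat (-n)"]) auto
    qed
    then show ?thesis using p(2) conn_trans by blast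
  qed
  moreover have "\<exists>n. q = X n" if q: "q \<in> ?P" "(x, q) \<in> conn" for q
  proof -
    have "(p, q) \<in> conn" using p(2) q(2) conn_sym conn_trans by blast
    then obtain m n where "(h ^^ m) p = (h ^^ n) q" by (auto simp: connected_rel_def)
    moreover have "(h ^^ m) p = (h ^^ n) (X (int m - int n))"
      using bi_infinite_path_funpow[OF path, of n "int m - int n"] by (simp add: X_def)
    ultimately show ?thesis using inj_pow[OF q(1) XP] by metis
  qed
  ultimately have range: "range X = ?P \<inter> conn `` {x}" using XP by blast
  have "\<exists>k. \<forall>n. Y n = X (n + k)" if Y: "bi_infinite_path S h Y" "range Y \<subseteq> conn `` {x}" for Y
  proof -
    have YP: "Y n \<in> ?P" for n using bi_infinite_path_primeval[OF Y(1)] .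
    then obtain k where k: "Y 0 = X k" using range Y(2) by blast
    have "Y n = X (n + k)" for n
    proof (cases "n \<ge> 0")
      case True
      then show ?thesis
        using bi_infinite_path_funpow[OF path, of "nat n" k] bi_infinite_path_funpow[OF Y(1), of "nat n" 0] k
        by (simp add: add.commute)
    next
      case False
      then show ?thesis
        using bi_infinite_path_funpow[OF path, of "nat (-n)" "n + k"] bi_infinite_path_funpow[OF Y(1), of "nat (-n)" n] k
        by (intro inj_pow[OF YP XP, of "nat (-n)"]) simp
    qed
    then show ?thesis by blast
  qed
  then show ?thesis using path range by blast
qed

text \<open>
  A chain of junior foils descends from the foil of \<open>x\<close> without end, so this finite foil meets every
  image set.
\<close>
lemma finite_foils_primeval:
  assumes junior: "\<And>y. (x, y) \<in> conn \<Longrightarrow> \<exists>z\<in>S. (h z, y) \<in> foil"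
    and fin: "\<And>y. (x, y) \<in> conn \<Longrightarrow> finite (foil `` {y})" and x: "x \<in> S"
  shows "\<exists>p\<in>primeval S h. (x, p) \<in> conn"
proof -
  have "\<exists>z. (x, z) \<in> conn \<and> ((h ^^ n) z, x) \<in> foil" for n
  proof (induction n)
    case 0
    then show ?case using x by (intro exI[of _ x]) (auto intro: connI foilI)
  next
    case (Suc n)
    then obtain z where z: "(x, z) \<in> conn" "((h ^^ n) z, x) \<in> foil" by blast
    obtain w where w: "w \<in> S" "(h w, z) \<in> foil" using junior[OF z(1)] by blast
    have "((h ^^ n) (h w), (h ^^ n) z) \<in> foil" using foil_funpow_cong w(2) .
    then have "((h ^^ Suc n) w, x) \<in> foil" using z(2) foil_trans by (metis comp_apply funpow_Suc_right)
    moreover have "(h w, w) \<in> conn" using w(1) by (intro connI[of _ _ 0 1]) (auto intro: maps)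
    then have "(x, w) \<in> conn" using z(1) w(2) foil_subset_conn conn_sym conn_trans by blast
    ultimately show ?case by blast
  qed
  then have "\<exists>y\<in>foil `` {x}. y \<in> (h ^^ n) ` S" for n
    using foil_sym by (fastforce simp: connected_rel_def)
  moreover have "(x, x) \<in> conn" using x by (auto intro: connI)
  then have "finite (foil `` {x})" by (rule fin)
  ultimately obtain y where "(x, y) \<in> foil" "y \<in> primeval S h"
    using primeval_in_finite[of "foil `` {x}"] by (auto simp: foil_rel_def)
  then show ?thesis using foil_subset_conn by auto
qed

text \<open>
  The trichotomy for one realisation. The five hypotheses on \<open>S\<close> and \<open>h\<close> are the almost sure
  properties of a flow-adapted point-shift that mass transport provides.
\<close>
theorem classification:
  assumes fibres: "\<And>y. y \<in> S \<Longrightarrow> finite {x \<in> S. h x = y}"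
    and sel1: "no_finite_selection S h (last_finite S h)"
    and sel2: "no_finite_selection S h (fruitless S h)"
    and inj: "inj_on h (primeval S h)"
    and fin: "\<And>y. y \<in> primeval S h \<Longrightarrow> finite (foil `` {y})"
    and C: "C \<in> graph_components G"
  shows "(class_FF S h C \<or> class_IF S h C \<or> class_II S h C) \<and>
      (class_FF S h C \<longrightarrow>
        finite (foils_in S h C) \<and> 1 \<le> card (foils_in S h C) \<and>
        (\<exists>p. cycle_in G C p \<and> (\<forall>q. cycle_in G C q \<longrightarrow> (\<exists>k. q = rotate k p)) \<and>
             length p = card (foils_in S h C) \<and>
             primeval S h \<inter> C = tail G ` set p)) \<and>
      (class_IF S h C \<longrightarrow>
        acyclic_on G C \<and>
        (\<forall>L\<in>foils_in S h C. has_junior_foil S h L) \<and>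
        (\<exists>X. bi_infinite_path S h X \<and> range X = primeval S h \<inter> C \<and>
             (\<forall>Y. bi_infinite_path S h Y \<and> range Y \<subseteq> C \<longrightarrow> (\<exists>k. \<forall>n. Y n = X (n + k))))) \<and>
      (class_II S h C \<longrightarrow>
        acyclic_on G C \<and> primeval S h \<inter> C = {})"
proof -
  obtain x where "x \<in> C" using component_nonempty[OF C] by blast
  then have Cx: "C = conn `` {x}" and xS: "x \<in> S"
    using component_eq[OF C] by (auto simp: connected_rel_def)
  have foils: "foils_in S h C = (\<lambda>y. foil `` {y}) ` C"
    unfolding Cx by (rule foils_in_conn[OF xS])
  have foil_sub: "foil `` {y} \<subseteq> C" if "y \<in> C" for y
    using that foil_subset_conn conn_trans unfolding Cx by blast
  have "class_FF S h C \<or> class_IF S h C \<or> class_II S h C"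
  proof (cases "finite C")
    case True
    then show ?thesis using foil_sub finite_subset by (fastforce simp: class_FF_def foils)
  next
    case False
    then show ?thesis
      using foils_all_finite_or_all_infinite[OF fibres sel1 xS]
      unfolding Cx class_IF_def class_II_def foils[unfolded Cx] by blast
  qed
  moreover have "(\<forall>L\<in>foils_in S h C. has_junior_foil S h L) \<and>
        (\<exists>X. bi_infinite_path S h X \<and> range X = primeval S h \<inter> C \<and>
             (\<forall>Y. bi_infinite_path S h Y \<and> range Y \<subseteq> C \<longrightarrow> (\<exists>k. \<forall>n. Y n = X (n + k))))"
    if IF: "class_IF S h C"
  proof -
    have inf: "infinite (conn `` {x})" and fins: "\<And>y. (x, y) \<in> conn \<Longrightarrow> finite (foil `` {y})"
      using IF unfolding class_IF_def foils unfolding Cx by blast+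
    have junior: "\<exists>z\<in>S. (h z, y) \<in> foil" if "(x, y) \<in> conn" for y
      by (rule junior_foils[OF sel2 xS inf _ that]) (rule fins)
    have "\<exists>p\<in>primeval S h. (x, p) \<in> conn"
      by (rule finite_foils_primeval[OF _ _ xS]) (rule junior fins, assumption)+
    then obtain p where p: "p \<in> primeval S h" "(x, p) \<in> conn" by auto
    have "has_junior_foil S h L" if "L \<in> foils_in S h C" for L
    proof -
      have "L \<in> (\<lambda>y. foil `` {y}) ` (conn `` {x})" using that unfolding foils unfolding Cx .
      then obtain y where y: "(x, y) \<in> conn" "L = foil `` {y}" by auto
      obtain z where "z \<in> S" "(h z, y) \<in> foil" using junior[OF y(1)] by auto
      then show ?thesis using foil_sym y(2) unfolding has_junior_foil_def by auto
    qed
    then show ?thesis using unique_path[OF fibres inj p] unfolding Cx by auto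
  qed
  moreover have "acyclic_on G C" if "infinite C"
    using infinite_component_acyclic[OF xS _ fin] that unfolding Cx by blast
  moreover have "primeval S h \<inter> C = {}" if "class_II S h C"
    using that fin unfolding class_II_def foils by auto
  moreover note finite_component_cycle[OF xS, folded Cx]
  ultimately show ?thesis unfolding class_FF_def class_IF_def class_II_def by blast
qed

end

section \<open>Symmetric windows and counting measures\<close>

lemma borel_measurable_group_uminus [measurable]:
  "(uminus :: 'x :: topological_group_add \<Rightarrow> 'x) \<in> borel_measurable borel"
  by (intro borel_measurable_continuous_onI continuous_intros)

text \<open>
  Symmetric windows make the inversion of the group harmless, so that the modular function and
  the image of the Haar measure under inversion never have to be discussed.
\<close>
lemma symmetric_compact_exhaustion:
  assumes "locally_compact_space (euclidean :: ('x :: {topological_group_add, second_countable_topology, t2_space}) topology)"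
  shows "\<exists>K :: nat \<Rightarrow> ('x :: {topological_group_add, second_countable_topology, t2_space}) set. (\<forall>n. compact (K n)) \<and> incseq K \<and> (\<Union>n. K n) = UNIV \<and>
    (\<forall>n x. - x \<in> K n \<longleftrightarrow> x \<in> K n)"
proof -
  define F where "F = {U :: 'x set. open U \<and> (\<exists>K. compact K \<and> U \<subseteq> K)}"
  have "\<exists>U\<in>F. x \<in> U" for x :: 'x
    using assms unfolding locally_compact_space_def F_def by (auto dest!: spec[of _ x])
  then have "\<Union>F = UNIV" by blast
  moreover have "\<And>U. U \<in> F \<Longrightarrow> open U" by (simp add: F_def)
  then obtain F' where F': "F' \<subseteq> F" "countable F'" "\<Union>F' = \<Union>F"
    by (rule Lindelof) auto
  ultimately have ne: "F' \<noteq> {}" by auto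
  have "\<forall>U\<in>F'. \<exists>K. compact K \<and> U \<subseteq> K" using F'(1) by (auto simp: F_def)
  then obtain k where k: "\<And>U. U \<in> F' \<Longrightarrow> compact (k U) \<and> U \<subseteq> k U" by metis
  define u where "u = from_nat_into F'"
  have u: "u n \<in> F'" for n using ne by (simp add: u_def from_nat_into)
  define K where "K n = (\<Union>i\<le>n. k (u i) \<union> uminus ` k (u i))" for n
  have "compact (K n)" for n
    unfolding K_def using k u
    by (intro compact_UN compact_Un compact_continuous_image continuous_intros) auto
  moreover have "incseq K"
    unfolding K_def incseq_def by (intro allI impI UN_mono) auto
  moreover have "(\<Union>n. K n) = UNIV"
  proof -
    have "\<exists>n. x \<in> K n" for x
    proof -
      obtain U where "U \<in> F'" "x \<in> U" using F'(3) \<open>\<Union>F = UNIV\<close> by auto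
      then obtain n where "x \<in> u n" using F'(2) from_nat_into_surj unfolding u_def by metis
      then show ?thesis using k[OF u[of n]] by (auto simp: K_def)
    qed
    then show ?thesis by auto
  qed
  moreover have "- x \<in> K n \<longleftrightarrow> x \<in> K n" for n x
  proof -
    have "y \<in> uminus ` A \<longleftrightarrow> - y \<in> A" for y :: 'x and A by (metis image_iff minus_minus)
    then show ?thesis unfolding K_def by auto
  qed
  ultimately show ?thesis by blast
qed

context
  fixes N :: "'x :: {topological_group_add, second_countable_topology, t2_space} measure"
  assumes lc: "locally_compact_space (euclidean :: 'x topology)"
    and counting: "locally_finite_counting_measure N" and simple: "simple_measure N"
begin

lemma sets_counting [measurable_cong]: "sets N = sets borel"
  using counting by (simp add: locally_finite_counting_measure_def)

lemma counting_values:
  assumes "B \<in> sets borel" "emeasure N B \<noteq> \<infinity>"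
  obtains n :: nat where "emeasure N B = of_nat n"
  using counting assms unfolding locally_finite_counting_measure_def by blast

lemma finite_atoms_compact:
  assumes "compact K" shows "finite (atoms N \<inter> K)"
proof (rule ccontr)
  assume inf: "infinite (atoms N \<inter> K)"
  have K: "K \<in> sets borel" using assms by (simp add: borel_compact)
  have "emeasure N K < \<infinity>" using counting assms by (simp add: locally_finite_counting_measure_def)
  then obtain n where n: "emeasure N K = of_nat n" using counting_values[OF K] less_irrefl by metis
  obtain F where F: "finite F" "card F = Suc n" "F \<subseteq> atoms N \<inter> K"
    using infinite_arbitrarily_large[OF inf] by blast
  have "emeasure N F = (\<Sum>x\<in>F. emeasure N {x})"
    by (rule emeasure_eq_sum_singleton) (use F sets_counting in auto)
  also have "\<dots> = (\<Sum>x\<in>F. 1)" using F simple by (intro sum.cong) (auto simp: simple_measure_def)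
  also have "\<dots> = of_nat (Suc n)" using F by simp
  finally have "emeasure N F = of_nat (Suc n)" .
  moreover have "emeasure N F \<le> emeasure N K"
    using F K sets_counting by (intro emeasure_mono) auto
  ultimately have "of_nat (Suc n) \<le> (of_nat n :: ennreal)" using n by metis
  then show False unfolding of_nat_le_iff by simp
qed

lemma countable_atoms: "countable (atoms N)"
proof -
  obtain K :: "nat \<Rightarrow> 'x set" where K: "\<forall>n. compact (K n)" "(\<Union>n. K n) = UNIV"
    using symmetric_compact_exhaustion[OF lc] by blast
  have "countable (\<Union>n. atoms N \<inter> K n)"
    using finite_atoms_compact K(1) by (intro countable_UN) (auto intro: countable_finite)
  moreover have "(\<Union>n. atoms N \<inter> K n) = atoms N" using K(2) by auto
  ultimately show ?thesis by simp
qed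

lemma borel_atoms: "atoms N \<in> sets borel"
  by (rule sets.countable[OF _ countable_atoms]) auto

text \<open>
  Neighbourhoods of \<open>x\<close> shrinking to \<open>{x}\<close> have measures that are integers and tend to \<open>0\<close>.
\<close>
lemma null_neighbourhood:
  assumes "x \<notin> atoms N"
  shows "\<exists>U. open U \<and> x \<in> U \<and> emeasure N U = 0"
proof -
  obtain V K where VK: "open V" "compact K" "x \<in> V" "V \<subseteq> K"
    using lc unfolding locally_compact_space_def by (auto dest!: spec[of _ x])
  obtain A :: "nat \<Rightarrow> 'x set" where A: "\<And>i. open (A i)" "\<And>i. x \<in> A i"
    "\<And>S. open S \<Longrightarrow> x \<in> S \<Longrightarrow> eventually (\<lambda>i. A i \<subseteq> S) sequentially"
    by (rule countable_basis_at_decseq) blast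
  define D where "D n = V \<inter> (\<Inter>i\<le>n. A i)" for n
  have openD: "open (D n)" for n unfolding D_def using A(1) VK(1) by (intro open_Int open_INT) auto
  have xD: "x \<in> D n" for n using A(2) VK(3) by (simp add: D_def)
  have "(\<Inter>n. D n) = {x}"
  proof
    show "(\<Inter>n. D n) \<subseteq> {x}"
    proof
      fix y assume y: "y \<in> (\<Inter>n. D n)"
      show "y \<in> {x}"
      proof (rule ccontr)
        assume "y \<notin> {x}"
        then obtain S where "open S" "x \<in> S" "y \<notin> S" by (metis hausdorff insertI1 disjoint_iff)
        then obtain i where "A i \<subseteq> S" using A(3) eventually_happens'[OF sequentially_bot] by blast
        then show False using y \<open>y \<notin> S\<close> by (auto simp: D_def)
      qed
    qed
  qed (use xD in auto)
  moreover have fin: "emeasure N (D i) \<noteq> \<infinity>" for i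
  proof -
    have "emeasure N (D i) \<le> emeasure N K"
      using VK by (intro emeasure_mono) (auto simp: D_def sets_counting borel_compact)
    also have "\<dots> < \<infinity>" using counting VK(2) by (simp add: locally_finite_counting_measure_def)
    finally show ?thesis by simp
  qed
  moreover have "range D \<subseteq> sets N" using openD sets_counting by auto
  moreover have "decseq D" by (auto simp: decseq_def D_def)
  ultimately have "(\<lambda>i. emeasure N (D i)) \<longlonglongrightarrow> emeasure N {x}"
    using Lim_emeasure_decseq[of D N] by simp
  then have "(\<lambda>i. emeasure N (D i)) \<longlonglongrightarrow> 0" using assms by (simp add: atoms_def)
  then have "eventually (\<lambda>i. emeasure N (D i) < 1) sequentially"
    by (rule order_tendstoD) simp
  then obtain i where i: "emeasure N (D i) < 1"
    using eventually_happens'[OF sequentially_bot] by blast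
  obtain n :: nat where n: "emeasure N (D i) = of_nat n"
    using counting_values[OF borel_open[OF openD] fin] .
  have "emeasure N (D i) = 0"
    using i unfolding n by (cases n) auto
  then show ?thesis using openD xD by blast
qed

lemma emeasure_minus_atoms: "emeasure N (- atoms N) = 0"
proof -
  define F where "F = {U. open U \<and> emeasure N U = 0}"
  have cover: "- atoms N \<subseteq> \<Union>F" using null_neighbourhood by (auto simp: F_def)
  have "\<And>U. U \<in> F \<Longrightarrow> open U" by (simp add: F_def)
  then obtain F' where F': "F' \<subseteq> F" "countable F'" "\<Union>F' = \<Union>F"
    by (rule Lindelof) auto
  have "(\<Union>U\<in>F'. U) \<in> null_sets N"
    using F' by (intro null_sets_UN') (auto simp: F_def null_sets_def sets_counting)
  then have "\<Union>F \<in> null_sets N" using F'(3) by simp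
  then have "- atoms N \<in> null_sets N"
    by (rule null_sets_subset[OF _ _ cover]) (use borel_atoms in \<open>simp add: sets_counting borel_comp\<close>)
  then show ?thesis by (rule null_setsD1)
qed

text \<open>
  By the Lindeloef property, countably many null neighbourhoods cover the complement of
  the atoms, so the atoms carry the whole measure. Integrals against the point process
  thereby become sums over its points.
\<close>
lemma counting_measure_eq_distr: "N = distr (count_space (atoms N)) borel (\<lambda>x. x)"
proof (rule measure_eqI)
  show "sets N = sets (distr (count_space (atoms N)) borel (\<lambda>x. x))" by (simp add: sets_counting)
  fix B assume "B \<in> sets N"
  then have B: "B \<in> sets borel" by (simp add: sets_counting)
  have "emeasure N B = emeasure N (B \<inter> atoms N) + emeasure N (B - atoms N)"
    using B borel_atoms by (subst plus_emeasure) (auto simp: sets_counting intro: arg_cong[where f="emeasure N"])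
  also have "emeasure N (B - atoms N) \<le> emeasure N (- atoms N)"
    using borel_atoms by (intro emeasure_mono) (auto simp: sets_counting)
  then have "emeasure N (B - atoms N) = 0" using emeasure_minus_atoms by simp
  also have "emeasure N (B \<inter> atoms N) = (\<integral>\<^sup>+x. emeasure N {x} \<partial>count_space (B \<inter> atoms N))"
    using countable_atoms by (intro emeasure_countable_singleton) (auto simp: sets_counting)
  also have "\<dots> = (\<integral>\<^sup>+x. 1 \<partial>count_space (B \<inter> atoms N))"
    using simple by (intro nn_integral_cong) (auto simp: simple_measure_def)
  also have "\<dots> = emeasure (count_space (B \<inter> atoms N)) (B \<inter> atoms N)"
    by simp
  also have "\<dots> = emeasure (count_space (atoms N)) (B \<inter> atoms N)"
    by (cases "finite (B \<inter> atoms N)") (auto simp: emeasure_count_space)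
  also have "\<dots> = emeasure (distr (count_space (atoms N)) borel (\<lambda>x. x)) B"
    using B by (subst emeasure_distr) (auto intro: arg_cong2[where f=emeasure])
  finally show "emeasure N B = emeasure (distr (count_space (atoms N)) borel (\<lambda>x. x)) B" by simp
qed

lemma nn_integral_counting:
  assumes "f \<in> borel_measurable borel"
  shows "(\<integral>\<^sup>+x. f x \<partial>N) = (\<integral>\<^sup>+x. f x \<partial>count_space (atoms N))"
  by (subst counting_measure_eq_distr, subst nn_integral_distr) (use assms in auto)

lemma sigma_finite_counting: "sigma_finite_measure N"
proof -
  obtain K :: "nat \<Rightarrow> 'x set" where K: "\<forall>n. compact (K n)" "(\<Union>n. K n) = UNIV"
    using symmetric_compact_exhaustion[OF lc] by blast
  show ?thesis
  proof
    show "\<exists>A. countable A \<and> A \<subseteq> sets N \<and> \<Union>A = space N \<and> (\<forall>a\<in>A. emeasure N a \<noteq> \<infinity>)"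
      using K counting sets_eq_imp_space_eq[OF sets_counting]
      by (intro exI[of _ "range K"])
        (auto simp: sets_counting locally_finite_counting_measure_def borel_compact less_top)
  qed
qed

end

section \<open>Measurability and flow covariance\<close>

lemma count_space_zero_iff: "emeasure (count_space UNIV) A = 0 \<longleftrightarrow> A = {}"
  by (cases "finite A") auto

lemma count_space_infinite_iff: "emeasure (count_space UNIV) A = top \<longleftrightarrow> infinite A"
  by (cases "finite A") auto

lemma measurable_at3:
  assumes f: "(\<lambda>((a, b), c). f a b c) \<in> (A \<Otimes>\<^sub>M B) \<Otimes>\<^sub>M C \<rightarrow>\<^sub>M R"
    and [measurable]: "a \<in> N \<rightarrow>\<^sub>M A" "b \<in> N \<rightarrow>\<^sub>M B" "c \<in> N \<rightarrow>\<^sub>M C"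
  shows "(\<lambda>n. f (a n) (b n) (c n)) \<in> N \<rightarrow>\<^sub>M R"
proof -
  have "(\<lambda>n. ((a n, b n), c n)) \<in> N \<rightarrow>\<^sub>M (A \<Otimes>\<^sub>M B) \<Otimes>\<^sub>M C" by measurable
  from measurable_compose[OF this f] show ?thesis by simp
qed

lemma measurable_at4:
  assumes f: "(\<lambda>(((a, b), c), d). f a b c d) \<in> ((A \<Otimes>\<^sub>M B) \<Otimes>\<^sub>M C) \<Otimes>\<^sub>M D \<rightarrow>\<^sub>M R"
    and [measurable]: "a \<in> N \<rightarrow>\<^sub>M A" "b \<in> N \<rightarrow>\<^sub>M B" "c \<in> N \<rightarrow>\<^sub>M C" "d \<in> N \<rightarrow>\<^sub>M D"
  shows "(\<lambda>n. f (a n) (b n) (c n) (d n)) \<in> N \<rightarrow>\<^sub>M R"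
proof -
  have "(\<lambda>n. (((a n, b n), c n), d n)) \<in> N \<rightarrow>\<^sub>M ((A \<Otimes>\<^sub>M B) \<Otimes>\<^sub>M C) \<Otimes>\<^sub>M D" by measurable
  from measurable_compose[OF this f] show ?thesis by simp
qed

locale unimodular_point_shift = point_shift M \<theta> \<mm> H
  for M :: "'w measure"
    and \<theta> :: "'x :: {topological_group_add, second_countable_topology, t2_space} \<Rightarrow> 'w \<Rightarrow> 'w"
    and \<mm> :: "'w \<Rightarrow> 'x measure"
    and H :: "'w \<Rightarrow> 'x \<Rightarrow> 'x" +
  fixes \<nu> :: "'x measure" and \<gamma> :: ennreal
  assumes lc: "locally_compact_space (euclidean :: 'x topology)"
    and haar: "left_haar_measure \<nu>" and unimodular: "right_invariant \<nu>"
    and intensity: "has_intensity M \<nu> \<mm> \<gamma>" and intensity_finite: "\<gamma> < \<infinity>"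
begin

abbreviation S where "S \<omega> \<equiv> atoms (\<mm> \<omega>)"

lemma sets_haar [measurable_cong]: "sets \<nu> = sets borel"
  using haar by (simp add: left_haar_measure_def)

lemma sets_process: "\<omega> \<in> space M \<Longrightarrow> sets (\<mm> \<omega>) = sets borel"
  using process_counting by (simp add: locally_finite_counting_measure_def)

lemma measurable_process: "\<omega> \<in> space M \<Longrightarrow> f \<in> borel \<rightarrow>\<^sub>M N \<Longrightarrow> f \<in> \<mm> \<omega> \<rightarrow>\<^sub>M N"
  using measurable_cong_sets[OF sets_process refl] by blast

lemma sigma_finite_haar: "sigma_finite_measure \<nu>"
proof -
  obtain K :: "nat \<Rightarrow> 'x set" where K: "\<forall>n. compact (K n)" "(\<Union>n. K n) = UNIV"
    using symmetric_compact_exhaustion[OF lc] by blast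
  show ?thesis
  proof
    show "\<exists>A. countable A \<and> A \<subseteq> sets \<nu> \<and> \<Union>A = space \<nu> \<and> (\<forall>a\<in>A. emeasure \<nu> a \<noteq> \<infinity>)"
      using K haar sets_eq_imp_space_eq[OF sets_haar]
      by (intro exI[of _ "range K"])
        (auto simp: sets_haar left_haar_measure_def borel_compact less_top)
  qed
qed

lemma sigma_finite_process: "\<omega> \<in> space M \<Longrightarrow> sigma_finite_measure (\<mm> \<omega>)"
  by (intro sigma_finite_counting lc process_counting process_simple)

lemma nn_integral_process:
  assumes "\<omega> \<in> space M" "f \<in> borel_measurable borel"
  shows "(\<integral>\<^sup>+x. f x \<partial>\<mm> \<omega>) = (\<integral>\<^sup>+x. f x \<partial>count_space (S \<omega>))"
  by (intro nn_integral_counting lc process_counting process_simple assms)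

lemma nn_integral_process_indicator:
  assumes "\<omega> \<in> space M" "Measurable.pred borel Q"
  shows "(\<integral>\<^sup>+x. indicator {x. Q x} x \<partial>\<mm> \<omega>) = emeasure (count_space UNIV) {x \<in> S \<omega>. Q x}"
proof -
  have "(\<integral>\<^sup>+x. indicator {x. Q x} x \<partial>\<mm> \<omega>) = (\<integral>\<^sup>+x. indicator {x. Q x} x \<partial>count_space (S \<omega>))"
    using assms(2) by (intro nn_integral_process assms(1)) measurable
  also have "\<dots> = (\<integral>\<^sup>+x. indicator {x \<in> S \<omega>. Q x} x \<partial>count_space (S \<omega>))"
    by (intro nn_integral_cong) (auto simp: indicator_def)
  also have "\<dots> = emeasure (count_space (S \<omega>)) {x \<in> S \<omega>. Q x}"
    by (rule nn_integral_indicator) auto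
  also have "\<dots> = emeasure (count_space UNIV) {x \<in> S \<omega>. Q x}"
    by (cases "finite {x \<in> S \<omega>. Q x}") (simp_all add: emeasure_count_space)
  finally show ?thesis .
qed

subsection \<open>Measurability\<close>

text \<open>
  The point process is a kernel from \<open>M\<close> to the Borel sets, but not a finite one. On a compact set it
  becomes a subprobability kernel after division by the number of points, to which the
  measurability theorem for such kernels applies; the compact exhaustion does the rest.
\<close>
lemma measurable_nn_integral_process [measurable (raw)]:
  assumes W [measurable]: "W \<in> N \<rightarrow>\<^sub>M M"
    and f [measurable]: "case_prod f \<in> borel_measurable (N \<Otimes>\<^sub>M borel)"
  shows "(\<lambda>n. \<integral>\<^sup>+x. f n x \<partial>\<mm> (W n)) \<in> borel_measurable N"
proof -
  obtain K :: "nat \<Rightarrow> 'x set" where K: "\<forall>n. compact (K n)" "incseq K" "(\<Union>n. K n) = UNIV"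
    using symmetric_compact_exhaustion[OF lc] by blast
  have KB [measurable]: "K i \<in> sets borel" for i using K by (auto intro: borel_compact)
  have WM: "W n \<in> space M" if "n \<in> space N" for n using that W by (rule measurable_space[rotated])
  have part: "(\<lambda>n. \<integral>\<^sup>+x. f n x * indicator (K i) x \<partial>\<mm> (W n)) \<in> borel_measurable N" for i
  proof -
    define c where "c n = emeasure (\<mm> (W n)) (K i)" for n
    have c [measurable]: "c \<in> borel_measurable N"
      unfolding c_def by (rule measurable_compose[OF W process_measurable]) simp
    \<comment> \<open>where \<open>c n = 0\<close> the density may be infinite, but only on a null set\<close>
    define L where "L n = density (\<mm> (W n)) (\<lambda>x. indicator (K i) x / c n)" for n
    have eL: "emeasure (L n) B = emeasure (\<mm> (W n)) (K i \<inter> B) / c n" if "n \<in> space N" "B \<in> sets borel" for n B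
    proof -
      have ind: "(\<lambda>x. indicator (K i) x / c n) \<in> borel_measurable (\<mm> (W n))"
        "indicator (K i \<inter> B) \<in> borel_measurable (\<mm> (W n))"
        using that(2) by (intro measurable_process WM[OF that(1)]; measurable)+
      have "emeasure (L n) B = (\<integral>\<^sup>+x. indicator (K i \<inter> B) x / c n \<partial>\<mm> (W n))"
        using that(2) ind(1) unfolding L_def
        by (subst emeasure_density)
          (auto intro!: nn_integral_cong split: split_indicator simp: sets_process[OF WM[OF that(1)]])
      also have "\<dots> = emeasure (\<mm> (W n)) (K i \<inter> B) / c n"
        using that(2) ind(2) KB by (subst nn_integral_divide) (auto simp: sets_process[OF WM[OF that(1)]])
      finally show ?thesis .
    qed
    have "L \<in> N \<rightarrow>\<^sub>M subprob_algebra borel"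
    proof (rule measurable_subprob_algebra)
      fix n assume n: "n \<in> space N"
      show sets: "sets (L n) = sets borel" by (simp add: L_def sets_process[OF WM[OF n]])
      have "a / a \<le> 1" for a :: ennreal
        by (cases "a = 0"; cases "a = top") (auto simp: less_top)
      then have "emeasure (L n) UNIV \<le> 1"
        using eL[OF n, of UNIV] by (simp add: c_def)
      then show "subprob_space (L n)"
        using sets_eq_imp_space_eq[OF sets] by (intro subprob_spaceI) auto
    next
      fix B :: "'x set" assume B: "B \<in> sets borel"
      have "(\<lambda>n. emeasure (\<mm> (W n)) (K i \<inter> B) / c n) \<in> borel_measurable N"
        using B by (intro borel_measurable_divide_ennreal c measurable_compose[OF W process_measurable]) auto
      then show "(\<lambda>n. emeasure (L n) B) \<in> borel_measurable N"
        using eL B by (subst measurable_cong) auto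
    qed
    then have "(\<lambda>n. integral\<^sup>N (L n) (f n)) \<in> borel_measurable N"
      by (rule nn_integral_measurable_subprob_algebra2[OF f])
    then have "(\<lambda>n. c n * integral\<^sup>N (L n) (f n)) \<in> borel_measurable N" by measurable
    moreover have "c n * integral\<^sup>N (L n) (f n) = (\<integral>\<^sup>+x. f n x * indicator (K i) x \<partial>\<mm> (W n))" if n: "n \<in> space N" for n
    proof -
      have fn: "f n \<in> borel_measurable borel"
        using measurable_compose[OF measurable_Pair1'[OF n] f] by simp
      have meas: "(\<lambda>x. indicator (K i) x / c n) \<in> borel_measurable (\<mm> (W n))"
        "f n \<in> borel_measurable (\<mm> (W n))"
        "(\<lambda>x. indicator (K i) x / c n * f n x) \<in> borel_measurable (\<mm> (W n))"
        using fn by (intro measurable_process WM[OF n]; measurable)+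
      have cfin: "c n \<noteq> \<infinity>"
        using K(1) process_counting[OF WM[OF n]] unfolding c_def locally_finite_counting_measure_def by (metis less_irrefl)
      have eq: "c n * integral\<^sup>N (L n) (f n) = (\<integral>\<^sup>+x. c n * (indicator (K i) x / c n * f n x) \<partial>\<mm> (W n))"
        unfolding L_def by (simp add: nn_integral_density nn_integral_cmult meas)
      show ?thesis
      proof (cases "c n = 0")
        case True
        then have "AE x in \<mm> (W n). x \<notin> K i"
          unfolding c_def by (intro AE_not_in) (auto simp: null_sets_def sets_process[OF WM[OF n]])
        then have "(\<integral>\<^sup>+x. f n x * indicator (K i) x \<partial>\<mm> (W n)) = (\<integral>\<^sup>+x. 0 \<partial>\<mm> (W n))"
          by (intro nn_integral_cong_AE) auto
        then show ?thesis using True by simp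
      next
        case False
        then have cc: "c n * (1 / c n) = 1" using cfin by (simp add: ennreal_times_divide less_top)
        have "c n * (indicator (K i) x / c n * f n x) = f n x * indicator (K i) x" for x
        proof (cases "x \<in> K i")
          case True
          then show ?thesis using cc by (simp add: mult.assoc[symmetric])
        qed simp
        then show ?thesis unfolding eq by simp
      qed
    qed
    ultimately show ?thesis by (rule measurable_cong[THEN iffD1, rotated])
  qed
  have "(\<lambda>n. SUP i. \<integral>\<^sup>+x. f n x * indicator (K i) x \<partial>\<mm> (W n)) \<in> borel_measurable N"
    using part by (intro borel_measurable_SUP) auto
  moreover have "(SUP i. \<integral>\<^sup>+x. f n x * indicator (K i) x \<partial>\<mm> (W n)) = (\<integral>\<^sup>+x. f n x \<partial>\<mm> (W n))" if n: "n \<in> space N" for n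
  proof -
    have fn: "f n \<in> borel_measurable borel"
      using measurable_compose[OF measurable_Pair1'[OF n] f] by simp
    have meas: "(\<lambda>x. f n x * indicator (K i) x) \<in> borel_measurable (\<mm> (W n))" for i
    proof (rule measurable_process[OF WM[OF n]])
      note fn [measurable]
      show "(\<lambda>x. f n x * indicator (K i) x) \<in> borel_measurable borel" by measurable
    qed
    have "(SUP i. f n x * indicator (K i) x) = f n x" for x
    proof (rule antisym)
      obtain i where "x \<in> K i" using K(3) by auto
      then show "f n x \<le> (SUP i. f n x * indicator (K i) x)"
        by (intro SUP_upper2[of i]) auto
    qed (auto intro!: SUP_least split: split_indicator)
    moreover have "incseq (\<lambda>i x. f n x * indicator (K i) x)"
      using K(2) by (auto simp: incseq_def le_fun_def split: split_indicator)
    ultimately show ?thesis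
      using meas by (subst nn_integral_monotone_convergence_SUP[symmetric]) auto
  qed
  ultimately show ?thesis by (rule measurable_cong[THEN iffD1, rotated])
qed

lemma measurable_count_atoms:
  assumes W [measurable]: "W \<in> N \<rightarrow>\<^sub>M M"
    and Q [measurable]: "Measurable.pred (N \<Otimes>\<^sub>M borel) (case_prod Q)"
  shows "(\<lambda>n. emeasure (count_space UNIV) {x \<in> S (W n). Q n x}) \<in> borel_measurable N"
proof -
  have "(\<lambda>n. \<integral>\<^sup>+x. indicator {x. Q n x} x \<partial>\<mm> (W n)) \<in> borel_measurable N"
  proof (rule measurable_nn_integral_process[OF W])
    have "(\<lambda>p. indicator {p. case_prod Q p} p :: ennreal) \<in> borel_measurable (N \<Otimes>\<^sub>M borel)" by measurable
    then show "(\<lambda>(n, x). indicator {x. Q n x} x :: ennreal) \<in> borel_measurable (N \<Otimes>\<^sub>M borel)"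
      by (rule back_subst[where P="\<lambda>f. f \<in> _"]) (auto simp: fun_eq_iff indicator_def)
  qed
  moreover have "(\<integral>\<^sup>+x. indicator {x. Q n x} x \<partial>\<mm> (W n)) = emeasure (count_space UNIV) {x \<in> S (W n). Q n x}"
    if n: "n \<in> space N" for n
  proof (rule nn_integral_process_indicator)
    show "W n \<in> space M" using n W by (rule measurable_space[rotated])
    show "Measurable.pred borel (Q n)"
      using measurable_compose[OF measurable_Pair1'[OF n] Q] by simp
  qed
  ultimately show ?thesis by (rule measurable_cong[THEN iffD1, rotated])
qed

text \<open>
  Quantification over the uncountable group is not measurable in general; quantification over
  the points of the process is, because it only asks whether a count is zero or infinite.
\<close>
lemma pred_finite_atoms [measurable (raw)]:
  assumes "W \<in> N \<rightarrow>\<^sub>M M" "Measurable.pred (N \<Otimes>\<^sub>M borel) (case_prod Q)"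
  shows "Measurable.pred N (\<lambda>n. finite {x \<in> S (W n). Q n x})"
proof -
  note [measurable] = measurable_count_atoms[OF assms]
  have "Measurable.pred N (\<lambda>n. emeasure (count_space UNIV) {x \<in> S (W n). Q n x} \<noteq> top)"
    by measurable
  then show ?thesis unfolding count_space_infinite_iff by simp
qed

lemma pred_ex_atoms [measurable (raw)]:
  assumes "W \<in> N \<rightarrow>\<^sub>M M" "Measurable.pred (N \<Otimes>\<^sub>M borel) (case_prod Q)"
  shows "Measurable.pred N (\<lambda>n. \<exists>x\<in>S (W n). Q n x)"
proof -
  note [measurable] = measurable_count_atoms[OF assms]
  have "Measurable.pred N (\<lambda>n. emeasure (count_space UNIV) {x \<in> S (W n). Q n x} \<noteq> 0)"
    by measurable
  moreover have "{x \<in> S (W n). Q n x} \<noteq> {} \<longleftrightarrow> (\<exists>x\<in>S (W n). Q n x)" for n by blast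
  ultimately show ?thesis unfolding count_space_zero_iff by simp
qed

lemma pred_ball_atoms [measurable (raw)]:
  assumes "W \<in> N \<rightarrow>\<^sub>M M" "Measurable.pred (N \<Otimes>\<^sub>M borel) (case_prod Q)"
  shows "Measurable.pred N (\<lambda>n. \<forall>x\<in>S (W n). Q n x)"
proof -
  have "Measurable.pred N (\<lambda>n. \<exists>x\<in>S (W n). \<not> Q n x)"
  proof (rule pred_ex_atoms[OF assms(1)])
    have "Measurable.pred (N \<Otimes>\<^sub>M borel) (\<lambda>p. \<not> case_prod Q p)" by (rule pred_intros_logic(2)[OF assms(2)])
    then show "Measurable.pred (N \<Otimes>\<^sub>M borel) (\<lambda>(n, x). \<not> Q n x)" by (simp add: case_prod_beta)
  qed
  then have "Measurable.pred N (\<lambda>n. \<not> (\<exists>x\<in>S (W n). \<not> Q n x))" by (rule pred_intros_logic(2))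
  then show ?thesis by simp
qed

lemma pred_group_eq [measurable (raw)]:
  fixes f g :: "_ \<Rightarrow> 'x"
  assumes [measurable]: "f \<in> N \<rightarrow>\<^sub>M borel" "g \<in> N \<rightarrow>\<^sub>M borel"
  shows "Measurable.pred N (\<lambda>n. f n = g n)"
  unfolding pred_def by measurable

lemma pred_atom [measurable (raw)]:
  assumes [measurable]: "W \<in> N \<rightarrow>\<^sub>M M" "X \<in> N \<rightarrow>\<^sub>M borel"
  shows "Measurable.pred N (\<lambda>n. X n \<in> S (W n))"
proof -
  have "Measurable.pred N (\<lambda>n. \<exists>x\<in>S (W n). x = X n)" by measurable
  then show ?thesis by (simp add: Bex_def)
qed

lemma measurable_shift_funpow [measurable (raw)]:
  assumes [measurable]: "W \<in> N \<rightarrow>\<^sub>M M" "X \<in> N \<rightarrow>\<^sub>M borel"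
  shows "(\<lambda>n. (H (W n) ^^ k) (X n)) \<in> N \<rightarrow>\<^sub>M borel"
proof (induction k)
  case (Suc k)
  have "(\<lambda>n. (W n, (H (W n) ^^ k) (X n))) \<in> N \<rightarrow>\<^sub>M M \<Otimes>\<^sub>M borel" using Suc by measurable
  from measurable_compose[OF this shift_measurable] show ?case by simp
qed simp

subsection \<open>Covariance\<close>

lemma flow_closed: "\<omega> \<in> space M \<Longrightarrow> \<theta> z \<omega> \<in> space M"
  using measurable_space[OF flow_measurable, of "(z, \<omega>)"] by (simp add: space_pair_measure)

lemma measurable_flow [measurable]: "\<theta> z \<in> M \<rightarrow>\<^sub>M M"
  using measurable_compose[OF measurable_Pair1'[of z borel M] flow_measurable] by simp

lemma group_uminus_add_eq: "(- z + y :: 'x) = x \<longleftrightarrow> y = z + x"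
  by (metis add.assoc add.left_neutral add.right_inverse add.left_inverse)

text \<open>
  The defining covariance of the process, as a statement on image measures. It carries every
  integral and every quantifier over the points of \<open>\<theta> z \<omega>\<close> back to the points of \<open>\<omega>\<close>.
\<close>
lemma process_shift:
  assumes \<omega>: "\<omega> \<in> space M"
  shows "\<mm> (\<theta> z \<omega>) = distr (\<mm> \<omega>) borel (\<lambda>x. z + x)"
proof (rule measure_eqI)
  show "sets (\<mm> (\<theta> z \<omega>)) = sets (distr (\<mm> \<omega>) borel (\<lambda>x. z + x))"
    using sets_process[OF flow_closed[OF \<omega>]] by simp
  fix B assume "B \<in> sets (\<mm> (\<theta> z \<omega>))"
  then have B: "B \<in> sets borel" using sets_process[OF flow_closed[OF \<omega>]] by simp
  have "(\<lambda>y. - z + y) ` B = (\<lambda>x. z + x) -` B"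
  proof (intro equalityI subsetI)
    fix x assume "x \<in> (\<lambda>x. z + x) -` B"
    then show "x \<in> (\<lambda>y. - z + y) ` B"
      by (intro image_eqI[of _ _ "z + x"]) (auto simp: add.assoc[symmetric])
  qed (auto simp: add.assoc[symmetric])
  moreover have "(\<lambda>x. z + x) \<in> \<mm> \<omega> \<rightarrow>\<^sub>M borel"
    by (rule measurable_process[OF \<omega>]) measurable
  ultimately show "emeasure (\<mm> (\<theta> z \<omega>)) B = emeasure (distr (\<mm> \<omega>) borel (\<lambda>x. z + x)) B"
    using process_flow[OF \<omega> B] B sets_eq_imp_space_eq[OF sets_process[OF \<omega>]]
    by (subst emeasure_distr) auto
qed

lemma nn_integral_process_shift:
  assumes "\<omega> \<in> space M" "f \<in> borel_measurable borel"
  shows "(\<integral>\<^sup>+x. f x \<partial>\<mm> (\<theta> z \<omega>)) = (\<integral>\<^sup>+x. f (z + x) \<partial>\<mm> \<omega>)"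
  unfolding process_shift[OF assms(1)]
  by (rule nn_integral_distr[OF measurable_process[OF assms(1)]]) (use assms(2) in simp_all)

lemma atom_shift: "\<omega> \<in> space M \<Longrightarrow> z + x \<in> S (\<theta> z \<omega>) \<longleftrightarrow> x \<in> S \<omega>"
  using process_flow[of \<omega> "{z + x}" z] by (simp add: atoms_def add.assoc[symmetric])

lemma bex_atom_shift: "\<omega> \<in> space M \<Longrightarrow> (\<exists>x\<in>S (\<theta> z \<omega>). Q x) \<longleftrightarrow> (\<exists>x\<in>S \<omega>. Q (z + x))"
  using atom_shift by (metis group_uminus_add_eq)

lemma ball_atom_shift: "\<omega> \<in> space M \<Longrightarrow> (\<forall>x\<in>S (\<theta> z \<omega>). Q x) \<longleftrightarrow> (\<forall>x\<in>S \<omega>. Q (z + x))"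
  using bex_atom_shift[of \<omega> z "\<lambda>x. \<not> Q x"] by blast

lemma Collect_shift: "(\<And>x. Q' (z + x) \<longleftrightarrow> Q x) \<Longrightarrow> {x. Q' x} = (\<lambda>x. z + x) ` {x :: 'x. Q x}"
  by (auto simp: image_iff) (metis group_uminus_add_eq)

lemma finite_shift: "(\<And>x. Q' (z + x) \<longleftrightarrow> Q x) \<Longrightarrow> finite {x. Q' x} \<longleftrightarrow> finite {x :: 'x. Q x}"
  by (simp add: Collect_shift[of Q' z Q] finite_image_iff inj_on_def)

lemma shift_funpow: "\<omega> \<in> space M \<Longrightarrow> (H (\<theta> z \<omega>) ^^ n) (z + x) = z + (H \<omega> ^^ n) x"
  by (induction n) (simp_all add: shift_flow)

lemma foil_shift:
  "\<omega> \<in> space M \<Longrightarrow> (z + x, z + y) \<in> foil_rel (S (\<theta> z \<omega>)) (H (\<theta> z \<omega>)) \<longleftrightarrow> (x, y) \<in> foil_rel (S \<omega>) (H \<omega>)"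
  by (simp add: foil_rel_def atom_shift shift_funpow)

lemma connected_shift:
  "\<omega> \<in> space M \<Longrightarrow> (z + x, z + y) \<in> connected_rel (S (\<theta> z \<omega>)) (H (\<theta> z \<omega>)) \<longleftrightarrow> (x, y) \<in> connected_rel (S \<omega>) (H \<omega>)"
  by (simp add: connected_rel_def atom_shift shift_funpow)

lemma finite_foil_shift:
  "\<omega> \<in> space M \<Longrightarrow> finite (foil_rel (S (\<theta> z \<omega>)) (H (\<theta> z \<omega>)) `` {z + x}) \<longleftrightarrow> finite (foil_rel (S \<omega>) (H \<omega>) `` {x})"
  unfolding Image_singleton by (rule finite_shift) (rule foil_shift)

lemma last_finite_shift:
  "\<omega> \<in> space M \<Longrightarrow> last_finite (S (\<theta> z \<omega>)) (H (\<theta> z \<omega>)) (z + x) \<longleftrightarrow> last_finite (S \<omega>) (H \<omega>) x"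
  by (simp add: last_finite_def finite_foil_shift shift_flow)

lemma fruitless_shift:
  "\<omega> \<in> space M \<Longrightarrow> fruitless (S (\<theta> z \<omega>)) (H (\<theta> z \<omega>)) (z + x) \<longleftrightarrow> fruitless (S \<omega>) (H \<omega>) x"
  by (simp add: fruitless_def ball_atom_shift shift_flow foil_shift)

lemma primeval_shift:
  "\<omega> \<in> space M \<Longrightarrow> z + x \<in> primeval (S (\<theta> z \<omega>)) (H (\<theta> z \<omega>)) \<longleftrightarrow> x \<in> primeval (S \<omega>) (H \<omega>)"
  by (simp add: primeval_def image_iff bex_atom_shift atom_shift shift_funpow)

lemma pred_foil [measurable (raw)]:
  assumes [measurable]: "W \<in> N \<rightarrow>\<^sub>M M" "X \<in> N \<rightarrow>\<^sub>M borel" "Y \<in> N \<rightarrow>\<^sub>M borel"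
  shows "Measurable.pred N (\<lambda>n. (X n, Y n) \<in> foil_rel (S (W n)) (H (W n)))"
  unfolding foil_rel_def mem_Collect_eq prod.case by measurable

lemma pred_connected [measurable (raw)]:
  assumes [measurable]: "W \<in> N \<rightarrow>\<^sub>M M" "X \<in> N \<rightarrow>\<^sub>M borel" "Y \<in> N \<rightarrow>\<^sub>M borel"
  shows "Measurable.pred N (\<lambda>n. (X n, Y n) \<in> connected_rel (S (W n)) (H (W n)))"
  unfolding connected_rel_def mem_Collect_eq prod.case by measurable

lemma pred_finite_foil [measurable (raw)]:
  assumes [measurable]: "W \<in> N \<rightarrow>\<^sub>M M" "X \<in> N \<rightarrow>\<^sub>M borel"
  shows "Measurable.pred N (\<lambda>n. finite (foil_rel (S (W n)) (H (W n)) `` {X n}))"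
proof -
  have "Measurable.pred N (\<lambda>n. finite {y \<in> S (W n). (X n, y) \<in> foil_rel (S (W n)) (H (W n))})"
    by measurable
  moreover have "{y \<in> S (W n). (X n, y) \<in> foil_rel (S (W n)) (H (W n))} = foil_rel (S (W n)) (H (W n)) `` {X n}" for n
    by (auto simp: foil_rel_def)
  ultimately show ?thesis by simp
qed

lemma pred_last_finite [measurable (raw)]:
  assumes [measurable]: "W \<in> N \<rightarrow>\<^sub>M M" "X \<in> N \<rightarrow>\<^sub>M borel"
  shows "Measurable.pred N (\<lambda>n. last_finite (S (W n)) (H (W n)) (X n))"
proof -
  have [measurable]: "(\<lambda>n. H (W n) (X n)) \<in> N \<rightarrow>\<^sub>M borel"
    using measurable_shift_funpow[OF assms, of 1] by simp
  show ?thesis unfolding last_finite_def by measurable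
qed

lemma pred_fruitless [measurable (raw)]:
  assumes [measurable]: "W \<in> N \<rightarrow>\<^sub>M M" "X \<in> N \<rightarrow>\<^sub>M borel"
  shows "Measurable.pred N (\<lambda>n. fruitless (S (W n)) (H (W n)) (X n))"
proof -
  have [measurable]: "(\<lambda>(n, y). H (W n) y) \<in> N \<Otimes>\<^sub>M borel \<rightarrow>\<^sub>M borel"
    using measurable_shift_funpow[of "\<lambda>p. W (fst p)" "N \<Otimes>\<^sub>M borel" snd 1] by (simp add: case_prod_beta)
  show ?thesis unfolding fruitless_def by measurable
qed

lemma pred_primeval [measurable (raw)]:
  assumes [measurable]: "W \<in> N \<rightarrow>\<^sub>M M" "X \<in> N \<rightarrow>\<^sub>M borel"
  shows "Measurable.pred N (\<lambda>n. X n \<in> primeval (S (W n)) (H (W n)))"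
  unfolding primeval_def image_iff mem_Collect_eq by measurable

section \<open>Mass transport\<close>

lemma measurable_haar: "f \<in> borel \<rightarrow>\<^sub>M N \<Longrightarrow> f \<in> \<nu> \<rightarrow>\<^sub>M N"
  using measurable_cong_sets[OF sets_haar refl] by blast

lemma haar_windows:
  "\<exists>A :: nat \<Rightarrow> 'x set. (\<forall>n. A n \<in> sets borel \<and> 0 < emeasure \<nu> (A n) \<and> emeasure \<nu> (A n) < \<infinity> \<and>
     (\<forall>x. - x \<in> A n \<longleftrightarrow> x \<in> A n)) \<and> (\<Union>n. A n) = UNIV"
proof -
  obtain K :: "nat \<Rightarrow> 'x set" where K: "\<forall>n. compact (K n)" "incseq K" "(\<Union>n. K n) = UNIV"
    "\<forall>n x. - x \<in> K n \<longleftrightarrow> x \<in> K n"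
    using symmetric_compact_exhaustion[OF lc] by blast
  have B: "K n \<in> sets borel" for n using K(1) by (auto intro: borel_compact)
  have "\<exists>n. emeasure \<nu> (K n) \<noteq> 0"
  proof (rule ccontr)
    assume "\<not> ?thesis"
    then have "(\<Union>n. K n) \<in> null_sets \<nu>" using B by (intro null_sets_UN) (auto simp: null_sets_def sets_haar)
    then show False using haar K(3) by (auto simp: left_haar_measure_def null_sets_def)
  qed
  then obtain m where m: "emeasure \<nu> (K m) \<noteq> 0" by blast
  have "0 < emeasure \<nu> (K (n + m))" for n
  proof -
    have "emeasure \<nu> (K m) \<le> emeasure \<nu> (K (n + m))"
      using K(2) B by (intro emeasure_mono) (auto simp: incseq_def sets_haar)
    then show ?thesis using m by (metis le_zero_eq not_gr_zero)
  qed
  moreover have "emeasure \<nu> (K (n + m)) < \<infinity>" for n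
    using haar K(1) by (simp add: left_haar_measure_def)
  moreover have "(\<Union>n. K (n + m)) = UNIV"
  proof -
    have "x \<in> (\<Union>n. K (n + m))" for x
    proof -
      obtain n where "x \<in> K n" using K(3) by blast
      moreover have "K n \<subseteq> K (n + m)" using K(2) by (simp add: incseq_def)
      ultimately show ?thesis by blast
    qed
    then show ?thesis by blast
  qed
  ultimately show ?thesis using B K(4) by (intro exI[of _ "\<lambda>n. K (n + m)"]) simp
qed

text \<open>
  The only place where right invariance, and thus unimodularity, is used.
\<close>
lemma haar_right_translate:
  assumes "A \<in> sets borel" shows "(\<integral>\<^sup>+z. indicator A (z + y) \<partial>\<nu>) = emeasure \<nu> A"
proof -
  have eq: "{z. z + y \<in> A} = (\<lambda>z. z + (- y)) ` A"
  proof (intro equalityI subsetI)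
    fix z assume "z \<in> {z. z + y \<in> A}"
    then show "z \<in> (\<lambda>z. z + (- y)) ` A" by (intro image_eqI[of _ _ "z + y"]) (auto simp: add.assoc)
  qed (auto simp: add.assoc)
  have "(\<lambda>z. z + y) -` A \<inter> space borel \<in> sets borel"
    using assms by (intro measurable_sets[where A=borel]) auto
  then have meas: "{z. z + y \<in> A} \<in> sets \<nu>" by (simp add: vimage_def sets_haar)
  have "(\<integral>\<^sup>+z. indicator A (z + y) \<partial>\<nu>) = (\<integral>\<^sup>+z. indicator {z. z + y \<in> A} z \<partial>\<nu>)"
    by (intro nn_integral_cong) (auto simp: indicator_def)
  also have "\<dots> = emeasure \<nu> {z. z + y \<in> A}" using meas by (rule nn_integral_indicator)
  also have "\<dots> = emeasure \<nu> A"
    unfolding eq using unimodular assms by (simp only: right_invariant_def)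
  finally show ?thesis .
qed

text \<open>
  Symmetry of \<open>A\<close> turns the inverted variable \<open>- z\<close> into a left translate: \<open>- z + x \<in> A\<close> iff
  \<open>- x + z \<in> A\<close>.
\<close>
lemma haar_inverted_translate:
  assumes "A \<in> sets borel" and sym: "\<forall>x. - x \<in> A \<longleftrightarrow> x \<in> A"
  shows "(\<integral>\<^sup>+z. indicator A (- z + x) \<partial>\<nu>) = emeasure \<nu> A"
proof -
  have neg: "- (- z + x) = - x + z" for z by (simp add: minus_add)
  have eq: "{z. - z + x \<in> A} = (\<lambda>z. x + z) ` A"
  proof (intro equalityI subsetI)
    fix z assume "z \<in> {z. - z + x \<in> A}"
    then have "- x + z \<in> A" using sym neg by (metis mem_Collect_eq)
    then show "z \<in> (\<lambda>z. x + z) ` A" by (intro image_eqI[of _ _ "- x + z"]) (auto simp: add.assoc[symmetric])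
  next
    fix z assume "z \<in> (\<lambda>z. x + z) ` A"
    then have "- x + z \<in> A" by (auto simp: add.assoc[symmetric])
    then show "z \<in> {z. - z + x \<in> A}" using sym neg by (metis mem_Collect_eq)
  qed
  have "(\<lambda>z. - z + x) \<in> borel \<rightarrow>\<^sub>M borel" by measurable
  then have "(\<lambda>z. - z + x) -` A \<inter> space borel \<in> sets borel"
    using assms(1) by (rule measurable_sets)
  then have meas: "{z. - z + x \<in> A} \<in> sets \<nu>" by (simp add: vimage_def sets_haar)
  have "(\<integral>\<^sup>+z. indicator A (- z + x) \<partial>\<nu>) = (\<integral>\<^sup>+z. indicator {z. - z + x \<in> A} z \<partial>\<nu>)"
    by (intro nn_integral_cong) (auto simp: indicator_def)
  also have "\<dots> = emeasure \<nu> {z. - z + x \<in> A}" using meas by (rule nn_integral_indicator)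
  also have "\<dots> = emeasure \<nu> A"
    unfolding eq using haar assms(1) by (simp only: left_haar_measure_def)
  finally show ?thesis .
qed

lemma haar_integral_inside:
  assumes g: "(\<lambda>(((z, \<omega>), x), y). g z \<omega> x y) \<in> borel_measurable (((borel \<Otimes>\<^sub>M M) \<Otimes>\<^sub>M borel) \<Otimes>\<^sub>M borel)"
  shows "(\<integral>\<^sup>+z. \<integral>\<^sup>+\<omega>. \<integral>\<^sup>+x. \<integral>\<^sup>+y. g z \<omega> x y \<partial>\<mm> \<omega> \<partial>\<mm> \<omega> \<partial>M \<partial>\<nu>)
       = (\<integral>\<^sup>+\<omega>. \<integral>\<^sup>+x. \<integral>\<^sup>+y. \<integral>\<^sup>+z. g z \<omega> x y \<partial>\<nu> \<partial>\<mm> \<omega> \<partial>\<mm> \<omega> \<partial>M)"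
proof -
  note [measurable (raw)] = measurable_at4[OF g]
  interpret nu: sigma_finite_measure \<nu> by (rule sigma_finite_haar)
  interpret P: pair_sigma_finite M \<nu> by unfold_locales
  have "borel_measurable (M \<Otimes>\<^sub>M \<nu>) = (borel_measurable (M \<Otimes>\<^sub>M borel) :: ('w \<times> 'x \<Rightarrow> ennreal) set)"
    by (intro measurable_cong_sets sets_pair_measure_cong sets_haar refl)
  moreover have "(\<lambda>(\<omega>, z). \<integral>\<^sup>+x. \<integral>\<^sup>+y. g z \<omega> x y \<partial>\<mm> \<omega> \<partial>\<mm> \<omega>) \<in> borel_measurable (M \<Otimes>\<^sub>M borel)"
    unfolding case_prod_beta' by measurable
  ultimately have inner: "(\<lambda>(\<omega>, z). \<integral>\<^sup>+x. \<integral>\<^sup>+y. g z \<omega> x y \<partial>\<mm> \<omega> \<partial>\<mm> \<omega>) \<in> borel_measurable (M \<Otimes>\<^sub>M \<nu>)"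
    by simp
  have "(\<integral>\<^sup>+z. \<integral>\<^sup>+\<omega>. \<integral>\<^sup>+x. \<integral>\<^sup>+y. g z \<omega> x y \<partial>\<mm> \<omega> \<partial>\<mm> \<omega> \<partial>M \<partial>\<nu>)
      = (\<integral>\<^sup>+\<omega>. \<integral>\<^sup>+z. \<integral>\<^sup>+x. \<integral>\<^sup>+y. g z \<omega> x y \<partial>\<mm> \<omega> \<partial>\<mm> \<omega> \<partial>\<nu> \<partial>M)"
    by (rule P.Fubini'[OF inner])
  also have "\<dots> = (\<integral>\<^sup>+\<omega>. \<integral>\<^sup>+x. \<integral>\<^sup>+y. \<integral>\<^sup>+z. g z \<omega> x y \<partial>\<nu> \<partial>\<mm> \<omega> \<partial>\<mm> \<omega> \<partial>M)"
  proof (rule nn_integral_cong)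
    fix \<omega> assume \<omega> [measurable]: "\<omega> \<in> space M"
    interpret m: sigma_finite_measure "\<mm> \<omega>" by (rule sigma_finite_process[OF \<omega>])
    interpret Q: pair_sigma_finite "\<mm> \<omega>" \<nu> by unfold_locales
    have cong: "borel_measurable (\<mm> \<omega> \<Otimes>\<^sub>M \<nu>) = (borel_measurable (borel \<Otimes>\<^sub>M borel) :: ('x \<times> 'x \<Rightarrow> ennreal) set)"
      by (intro measurable_cong_sets sets_pair_measure_cong sets_process[OF \<omega>] sets_haar refl)
    have "(\<lambda>(x, z). \<integral>\<^sup>+y. g z \<omega> x y \<partial>\<mm> \<omega>) \<in> borel_measurable (borel \<Otimes>\<^sub>M borel)"
      unfolding case_prod_beta
      by (rule measurable_nn_integral_process[where W="\<lambda>_. \<omega>"]; measurable)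
    then have "(\<integral>\<^sup>+z. \<integral>\<^sup>+x. \<integral>\<^sup>+y. g z \<omega> x y \<partial>\<mm> \<omega> \<partial>\<mm> \<omega> \<partial>\<nu>) = (\<integral>\<^sup>+x. \<integral>\<^sup>+z. \<integral>\<^sup>+y. g z \<omega> x y \<partial>\<mm> \<omega> \<partial>\<nu> \<partial>\<mm> \<omega>)"
      by (intro Q.Fubini') (simp add: cong)
    also have "\<dots> = (\<integral>\<^sup>+x. \<integral>\<^sup>+y. \<integral>\<^sup>+z. g z \<omega> x y \<partial>\<nu> \<partial>\<mm> \<omega> \<partial>\<mm> \<omega>)"
    proof (rule nn_integral_cong)
      fix x
      have "(\<lambda>(y, z). g z \<omega> x y) \<in> borel_measurable (borel \<Otimes>\<^sub>M borel)"
        unfolding case_prod_beta by (rule measurable_at4[OF g]; measurable)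
      then show "(\<integral>\<^sup>+z. \<integral>\<^sup>+y. g z \<omega> x y \<partial>\<mm> \<omega> \<partial>\<nu>) = (\<integral>\<^sup>+y. \<integral>\<^sup>+z. g z \<omega> x y \<partial>\<nu> \<partial>\<mm> \<omega>)"
        by (intro Q.Fubini') (simp add: cong)
    qed
    finally show "(\<integral>\<^sup>+z. \<integral>\<^sup>+x. \<integral>\<^sup>+y. g z \<omega> x y \<partial>\<mm> \<omega> \<partial>\<mm> \<omega> \<partial>\<nu>)
       = (\<integral>\<^sup>+x. \<integral>\<^sup>+y. \<integral>\<^sup>+z. g z \<omega> x y \<partial>\<nu> \<partial>\<mm> \<omega> \<partial>\<mm> \<omega>)" .
  qed
  finally show ?thesis .
qed

lemma nn_integral_pairs_multc:
  assumes f: "(\<lambda>((\<omega>, x), y). f \<omega> x y) \<in> borel_measurable ((M \<Otimes>\<^sub>M borel) \<Otimes>\<^sub>M borel)"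
  shows "(\<integral>\<^sup>+\<omega>. \<integral>\<^sup>+x. \<integral>\<^sup>+y. f \<omega> x y * c \<partial>\<mm> \<omega> \<partial>\<mm> \<omega> \<partial>M) = (\<integral>\<^sup>+\<omega>. \<integral>\<^sup>+x. \<integral>\<^sup>+y. f \<omega> x y \<partial>\<mm> \<omega> \<partial>\<mm> \<omega> \<partial>M) * c"
proof -
  note [measurable (raw)] = measurable_at3[OF f]
  have m1: "(\<lambda>y. f \<omega> x y) \<in> borel_measurable (\<mm> \<omega>)" if [measurable]: "\<omega> \<in> space M" for \<omega> x
    by (rule measurable_process[OF that]) measurable
  have m2: "(\<lambda>x. \<integral>\<^sup>+y. f \<omega> x y \<partial>\<mm> \<omega>) \<in> borel_measurable (\<mm> \<omega>)" if [measurable]: "\<omega> \<in> space M" for \<omega>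
  proof (rule measurable_process[OF that], rule measurable_nn_integral_process[where W="\<lambda>_. \<omega>"])
    show "case_prod (f \<omega>) \<in> borel_measurable (borel \<Otimes>\<^sub>M borel)"
      unfolding case_prod_beta' by measurable
  qed measurable
  have m3: "(\<lambda>\<omega>. \<integral>\<^sup>+x. \<integral>\<^sup>+y. f \<omega> x y \<partial>\<mm> \<omega> \<partial>\<mm> \<omega>) \<in> borel_measurable M"
  proof (rule measurable_nn_integral_process)
    show "(\<lambda>(\<omega>, x). \<integral>\<^sup>+y. f \<omega> x y \<partial>\<mm> \<omega>) \<in> borel_measurable (M \<Otimes>\<^sub>M borel)"
      unfolding case_prod_beta'
    proof (rule measurable_nn_integral_process)
      show "(\<lambda>(p, y). f (fst p) (snd p) y) \<in> borel_measurable ((M \<Otimes>\<^sub>M borel) \<Otimes>\<^sub>M borel)"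
        unfolding case_prod_beta' by measurable
    qed measurable
  qed measurable
  have "(\<integral>\<^sup>+\<omega>. \<integral>\<^sup>+x. \<integral>\<^sup>+y. f \<omega> x y * c \<partial>\<mm> \<omega> \<partial>\<mm> \<omega> \<partial>M) = (\<integral>\<^sup>+\<omega>. (\<integral>\<^sup>+x. \<integral>\<^sup>+y. f \<omega> x y \<partial>\<mm> \<omega> \<partial>\<mm> \<omega>) * c \<partial>M)"
    by (intro nn_integral_cong) (simp add: nn_integral_multc m1 m2)
  also have "\<dots> = (\<integral>\<^sup>+\<omega>. \<integral>\<^sup>+x. \<integral>\<^sup>+y. f \<omega> x y \<partial>\<mm> \<omega> \<partial>\<mm> \<omega> \<partial>M) * c"
    by (rule nn_integral_multc[OF m3])
  finally show ?thesis .
qed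

text \<open>
  Write \<open>\<nu> A\<close> as the integral of \<open>indicator A (z + y)\<close> over \<open>z\<close> and take it out of the mean outgoing
  mass. Stationarity allows to shift everything by \<open>z\<close> for fixed \<open>z\<close>: the indicator of \<open>y\<close> loses its
  \<open>z\<close>, and that of \<open>x\<close> becomes \<open>indicator A (- z + x)\<close>. Integrating over \<open>z\<close> again leaves the
  mean incoming mass times \<open>\<nu> A\<close>, and \<open>\<nu> A\<close> cancels.
\<close>
theorem mass_transport:
  assumes f: "(\<lambda>((\<omega>, x), y). f \<omega> x y) \<in> borel_measurable ((M \<Otimes>\<^sub>M borel) \<Otimes>\<^sub>M borel)"
    and inv: "\<And>\<omega> z x y. \<omega> \<in> space M \<Longrightarrow> f (\<theta> z \<omega>) (z + x) (z + y) = f \<omega> x y"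
    and A: "A \<in> sets borel" "0 < emeasure \<nu> A" "emeasure \<nu> A < \<infinity>" "\<forall>x. - x \<in> A \<longleftrightarrow> x \<in> A"
  shows "(\<integral>\<^sup>+\<omega>. \<integral>\<^sup>+x. \<integral>\<^sup>+y. indicator A x * f \<omega> x y \<partial>\<mm> \<omega> \<partial>\<mm> \<omega> \<partial>M)
       = (\<integral>\<^sup>+\<omega>. \<integral>\<^sup>+y. \<integral>\<^sup>+x. indicator A y * f \<omega> x y \<partial>\<mm> \<omega> \<partial>\<mm> \<omega> \<partial>M)"
proof -
  note [measurable (raw)] = measurable_at3[OF f]
  note [measurable] = A(1)
  define g where "g z \<omega> x y = indicator A x * indicator A (z + y) * f \<omega> x y" for z \<omega> x y
  define g' where "g' z \<omega> x y = indicator A (- z + x) * indicator A y * f \<omega> x y" for z \<omega> x y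
  have fx: "(\<lambda>((\<omega>, x), y). indicator A x * f \<omega> x y) \<in> borel_measurable ((M \<Otimes>\<^sub>M borel) \<Otimes>\<^sub>M borel)"
    and fy: "(\<lambda>((\<omega>, x), y). indicator A y * f \<omega> x y) \<in> borel_measurable ((M \<Otimes>\<^sub>M borel) \<Otimes>\<^sub>M borel)"
    unfolding case_prod_beta' by measurable
  have g: "(\<lambda>(((z, \<omega>), x), y). g z \<omega> x y) \<in> borel_measurable (((borel \<Otimes>\<^sub>M M) \<Otimes>\<^sub>M borel) \<Otimes>\<^sub>M borel)"
    and g': "(\<lambda>(((z, \<omega>), x), y). g' z \<omega> x y) \<in> borel_measurable (((borel \<Otimes>\<^sub>M M) \<Otimes>\<^sub>M borel) \<Otimes>\<^sub>M borel)"
    unfolding g_def g'_def case_prod_beta by measurable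
  have "(\<integral>\<^sup>+\<omega>. \<integral>\<^sup>+x. \<integral>\<^sup>+y. indicator A x * f \<omega> x y \<partial>\<mm> \<omega> \<partial>\<mm> \<omega> \<partial>M) * emeasure \<nu> A
      = (\<integral>\<^sup>+\<omega>. \<integral>\<^sup>+x. \<integral>\<^sup>+y. indicator A x * f \<omega> x y * emeasure \<nu> A \<partial>\<mm> \<omega> \<partial>\<mm> \<omega> \<partial>M)"
    by (rule nn_integral_pairs_multc[OF fx, symmetric])
  also have "\<dots> = (\<integral>\<^sup>+\<omega>. \<integral>\<^sup>+x. \<integral>\<^sup>+y. \<integral>\<^sup>+z. g z \<omega> x y \<partial>\<nu> \<partial>\<mm> \<omega> \<partial>\<mm> \<omega> \<partial>M)"
  proof (intro nn_integral_cong)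
    fix \<omega> x y
    have "(\<integral>\<^sup>+z. g z \<omega> x y \<partial>\<nu>) = (\<integral>\<^sup>+z. indicator A x * f \<omega> x y * indicator A (z + y) \<partial>\<nu>)"
      by (intro nn_integral_cong) (simp add: g_def ac_simps)
    also have "\<dots> = indicator A x * f \<omega> x y * (\<integral>\<^sup>+z. indicator A (z + y) \<partial>\<nu>)"
      by (rule nn_integral_cmult, rule measurable_haar) measurable
    finally show "indicator A x * f \<omega> x y * emeasure \<nu> A = (\<integral>\<^sup>+z. g z \<omega> x y \<partial>\<nu>)"
      by (simp add: haar_right_translate A(1))
  qed
  also have "\<dots> = (\<integral>\<^sup>+z. \<integral>\<^sup>+\<omega>. \<integral>\<^sup>+x. \<integral>\<^sup>+y. g z \<omega> x y \<partial>\<mm> \<omega> \<partial>\<mm> \<omega> \<partial>M \<partial>\<nu>)"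
    by (rule haar_integral_inside[OF g, symmetric])
  also have "\<dots> = (\<integral>\<^sup>+z. \<integral>\<^sup>+\<omega>. \<integral>\<^sup>+x. \<integral>\<^sup>+y. g' z \<omega> x y \<partial>\<mm> \<omega> \<partial>\<mm> \<omega> \<partial>M \<partial>\<nu>)"
  proof (rule nn_integral_cong)
    fix z :: 'x
    define \<psi> where "\<psi> \<omega> = (\<integral>\<^sup>+x. \<integral>\<^sup>+y. g' z \<omega> x y \<partial>\<mm> \<omega> \<partial>\<mm> \<omega>)" for \<omega>
    note [measurable (raw)] = measurable_at4[OF g']
    have \<psi>: "\<psi> \<in> borel_measurable M"
      unfolding \<psi>_def by measurable
    have "(\<integral>\<^sup>+x. \<integral>\<^sup>+y. g z \<omega> x y \<partial>\<mm> \<omega> \<partial>\<mm> \<omega>) = \<psi> (\<theta> z \<omega>)" if \<omega>: "\<omega> \<in> space M" for \<omega>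
    proof -
      note \<omega>z [measurable] = flow_closed[OF \<omega>, of z]
      have "\<psi> (\<theta> z \<omega>) = (\<integral>\<^sup>+x. \<integral>\<^sup>+y. g' z (\<theta> z \<omega>) (z + x) y \<partial>\<mm> (\<theta> z \<omega>) \<partial>\<mm> \<omega>)"
        unfolding \<psi>_def
        by (rule nn_integral_process_shift[OF \<omega>], rule measurable_nn_integral_process[where W="\<lambda>_. \<theta> z \<omega>"]; measurable)
      also have "\<dots> = (\<integral>\<^sup>+x. \<integral>\<^sup>+y. g' z (\<theta> z \<omega>) (z + x) (z + y) \<partial>\<mm> \<omega> \<partial>\<mm> \<omega>)"
        by (intro nn_integral_cong nn_integral_process_shift[OF \<omega>]) measurable
      also have "\<dots> = (\<integral>\<^sup>+x. \<integral>\<^sup>+y. g z \<omega> x y \<partial>\<mm> \<omega> \<partial>\<mm> \<omega>)"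
        by (intro nn_integral_cong) (simp add: g_def g'_def inv[OF \<omega>] add.assoc[symmetric])
      finally show ?thesis by simp
    qed
    then have "(\<integral>\<^sup>+\<omega>. \<integral>\<^sup>+x. \<integral>\<^sup>+y. g z \<omega> x y \<partial>\<mm> \<omega> \<partial>\<mm> \<omega> \<partial>M) = (\<integral>\<^sup>+\<omega>. \<psi> (\<theta> z \<omega>) \<partial>M)"
      by (intro nn_integral_cong) auto
    also have "\<dots> = (\<integral>\<^sup>+\<omega>. \<psi> \<omega> \<partial>distr M M (\<theta> z))"
      by (subst nn_integral_distr[OF measurable_flow]) (simp_all add: \<psi>)
    also have "\<dots> = (\<integral>\<^sup>+\<omega>. \<psi> \<omega> \<partial>M)" by (simp only: flow_preserves)
    finally show "(\<integral>\<^sup>+\<omega>. \<integral>\<^sup>+x. \<integral>\<^sup>+y. g z \<omega> x y \<partial>\<mm> \<omega> \<partial>\<mm> \<omega> \<partial>M) = (\<integral>\<^sup>+\<omega>. \<integral>\<^sup>+x. \<integral>\<^sup>+y. g' z \<omega> x y \<partial>\<mm> \<omega> \<partial>\<mm> \<omega> \<partial>M)"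
      by (simp add: \<psi>_def)
  qed
  also have "\<dots> = (\<integral>\<^sup>+\<omega>. \<integral>\<^sup>+x. \<integral>\<^sup>+y. \<integral>\<^sup>+z. g' z \<omega> x y \<partial>\<nu> \<partial>\<mm> \<omega> \<partial>\<mm> \<omega> \<partial>M)"
    by (rule haar_integral_inside[OF g'])
  also have "\<dots> = (\<integral>\<^sup>+\<omega>. \<integral>\<^sup>+x. \<integral>\<^sup>+y. indicator A y * f \<omega> x y * emeasure \<nu> A \<partial>\<mm> \<omega> \<partial>\<mm> \<omega> \<partial>M)"
  proof (intro nn_integral_cong)
    fix \<omega> x y
    have "(\<integral>\<^sup>+z. g' z \<omega> x y \<partial>\<nu>) = (\<integral>\<^sup>+z. indicator A y * f \<omega> x y * indicator A (- z + x) \<partial>\<nu>)"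
      by (intro nn_integral_cong) (simp add: g'_def ac_simps)
    also have "\<dots> = indicator A y * f \<omega> x y * (\<integral>\<^sup>+z. indicator A (- z + x) \<partial>\<nu>)"
      by (rule nn_integral_cmult, rule measurable_haar) measurable
    finally show "(\<integral>\<^sup>+z. g' z \<omega> x y \<partial>\<nu>) = indicator A y * f \<omega> x y * emeasure \<nu> A"
      by (simp add: haar_inverted_translate A)
  qed
  also have "\<dots> = (\<integral>\<^sup>+\<omega>. \<integral>\<^sup>+x. \<integral>\<^sup>+y. indicator A y * f \<omega> x y \<partial>\<mm> \<omega> \<partial>\<mm> \<omega> \<partial>M) * emeasure \<nu> A"
    by (rule nn_integral_pairs_multc[OF fy])
  finally have "(\<integral>\<^sup>+\<omega>. \<integral>\<^sup>+x. \<integral>\<^sup>+y. indicator A x * f \<omega> x y \<partial>\<mm> \<omega> \<partial>\<mm> \<omega> \<partial>M)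
      = (\<integral>\<^sup>+\<omega>. \<integral>\<^sup>+x. \<integral>\<^sup>+y. indicator A y * f \<omega> x y \<partial>\<mm> \<omega> \<partial>\<mm> \<omega> \<partial>M)"
    using A(2,3) by (auto simp: mult.commute[of _ "emeasure \<nu> A"] ennreal_mult_cancel_left)
  also have "\<dots> = (\<integral>\<^sup>+\<omega>. \<integral>\<^sup>+y. \<integral>\<^sup>+x. indicator A y * f \<omega> x y \<partial>\<mm> \<omega> \<partial>\<mm> \<omega> \<partial>M)"
  proof (rule nn_integral_cong)
    fix \<omega> assume \<omega> [measurable]: "\<omega> \<in> space M"
    interpret m: sigma_finite_measure "\<mm> \<omega>" by (rule sigma_finite_process[OF \<omega>])
    interpret Q: pair_sigma_finite "\<mm> \<omega>" "\<mm> \<omega>" by unfold_locales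
    have cong: "borel_measurable (\<mm> \<omega> \<Otimes>\<^sub>M \<mm> \<omega>) = (borel_measurable (borel \<Otimes>\<^sub>M borel) :: ('x \<times> 'x \<Rightarrow> ennreal) set)"
      by (intro measurable_cong_sets sets_pair_measure_cong sets_process[OF \<omega>] refl)
    have "(\<lambda>(y, x). indicator A y * f \<omega> x y) \<in> borel_measurable (borel \<Otimes>\<^sub>M borel)"
      unfolding case_prod_beta' by measurable
    then show "(\<integral>\<^sup>+x. \<integral>\<^sup>+y. indicator A y * f \<omega> x y \<partial>\<mm> \<omega> \<partial>\<mm> \<omega>) = (\<integral>\<^sup>+y. \<integral>\<^sup>+x. indicator A y * f \<omega> x y \<partial>\<mm> \<omega> \<partial>\<mm> \<omega>)"
      by (intro Q.Fubini') (simp add: cong)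
  qed
  finally show ?thesis .
qed

section \<open>Almost sure consequences\<close>

lemma mean_count_finite:
  assumes "A \<in> sets borel" "0 < emeasure \<nu> A" "emeasure \<nu> A < \<infinity>"
  shows "(\<integral>\<^sup>+\<omega>. emeasure (\<mm> \<omega>) A \<partial>M) < \<infinity>"
proof (rule ccontr)
  assume "\<not> ?thesis"
  then have "(\<integral>\<^sup>+\<omega>. emeasure (\<mm> \<omega>) A \<partial>M) = top" by (metis infinity_ennreal_def top.not_eq_extremum)
  moreover have "(\<integral>\<^sup>+\<omega>. emeasure (\<mm> \<omega>) A \<partial>M) / emeasure \<nu> A = \<gamma>"
    using intensity assms unfolding has_intensity_def by blast
  ultimately show False using assms(3) intensity_finite by (auto simp: ennreal_top_divide split: if_splits)
qed

lemma nn_integral_process_window: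
  assumes "\<omega> \<in> space M" "A \<in> sets borel"
  shows "(\<integral>\<^sup>+x. indicator A x \<partial>\<mm> \<omega>) = emeasure (\<mm> \<omega>) A"
  using assms by (intro nn_integral_indicator) (simp add: sets_process)

text \<open>
  Countably many windows cover the group, so almost sure statements on points may be proved
  one window at a time, where means are finite.
\<close>
lemma AE_all_windows:
  assumes "\<And>A. A \<in> sets borel \<Longrightarrow> 0 < emeasure \<nu> A \<Longrightarrow> emeasure \<nu> A < \<infinity> \<Longrightarrow> \<forall>x. - x \<in> A \<longleftrightarrow> x \<in> A \<Longrightarrow>
      AE \<omega> in M. \<forall>y\<in>S \<omega> \<inter> A. P \<omega> y"
  shows "AE \<omega> in M. \<forall>y\<in>S \<omega>. P \<omega> y"
proof -
  obtain A :: "nat \<Rightarrow> 'x set" where A: "\<forall>n. A n \<in> sets borel \<and> 0 < emeasure \<nu> (A n) \<and> emeasure \<nu> (A n) < \<infinity> \<and>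
     (\<forall>x. - x \<in> A n \<longleftrightarrow> x \<in> A n)" "(\<Union>n. A n) = UNIV"
    using haar_windows by blast
  have "AE \<omega> in M. \<forall>n. \<forall>y\<in>S \<omega> \<inter> A n. P \<omega> y"
    unfolding AE_all_countable using assms A(1) by simp
  then show ?thesis
  proof (rule AE_mp, intro AE_I2 impI ballI)
    fix \<omega> y assume "\<forall>n. \<forall>y\<in>S \<omega> \<inter> A n. P \<omega> y" "y \<in> S \<omega>"
    moreover obtain n where "y \<in> A n" using A(2) by blast
    ultimately show "P \<omega> y" by blast
  qed
qed

text \<open>
  Each point \<open>x\<close> distributes mass \<open>1\<close> evenly over the set of \<open>y\<close> with \<open>R \<omega> x y\<close>, provided this set is
  finite and nonempty. Infinitely many points sharing the same finite set \<open>F\<close> would load each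
  point of \<open>F\<close> with infinite mass, although the mean received mass in a window is finite.
\<close>
theorem finitely_many_sources:
  assumes R: "Measurable.pred ((M \<Otimes>\<^sub>M borel) \<Otimes>\<^sub>M borel) (\<lambda>((\<omega>, x), y). R \<omega> x y)"
    and inv: "\<And>\<omega> z x y. \<omega> \<in> space M \<Longrightarrow> R (\<theta> z \<omega>) (z + x) (z + y) \<longleftrightarrow> R \<omega> x y"
  shows "AE \<omega> in M. \<forall>F. finite F \<longrightarrow> F \<noteq> {} \<longrightarrow> finite {x \<in> S \<omega>. {y \<in> S \<omega>. R \<omega> x y} = F}"
proof -
  note [measurable (raw)] = measurable_at3[OF R]
  define i where "i \<omega> x y = (if R \<omega> x y then 1 else 0 :: ennreal)" for \<omega> x y
  have im: "(\<lambda>((\<omega>, x), y). i \<omega> x y) \<in> borel_measurable ((M \<Otimes>\<^sub>M borel) \<Otimes>\<^sub>M borel)"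
    unfolding i_def case_prod_beta' by measurable
  note [measurable (raw)] = measurable_at3[OF im]
  define c where "c \<omega> x = (\<integral>\<^sup>+y. i \<omega> x y \<partial>\<mm> \<omega>)" for \<omega> x
  have cm: "(\<lambda>(\<omega>, x). c \<omega> x) \<in> borel_measurable (M \<Otimes>\<^sub>M borel)"
    unfolding c_def case_prod_beta'
  proof (rule measurable_nn_integral_process)
    show "(\<lambda>(p, y). i (fst p) (snd p) y) \<in> borel_measurable ((M \<Otimes>\<^sub>M borel) \<Otimes>\<^sub>M borel)"
      unfolding case_prod_beta' by measurable
  qed measurable
  \<comment> \<open>\<open>inverse top = 0\<close>: a point with infinitely many targets sends nothing\<close>
  define f where "f \<omega> x y = i \<omega> x y * inverse (c \<omega> x)" for \<omega> x y
  have fm: "(\<lambda>((\<omega>, x), y). f \<omega> x y) \<in> borel_measurable ((M \<Otimes>\<^sub>M borel) \<Otimes>\<^sub>M borel)"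
  proof -
    have "(\<lambda>p. c (fst (fst p)) (snd (fst p))) \<in> borel_measurable ((M \<Otimes>\<^sub>M borel) \<Otimes>\<^sub>M borel)"
      using measurable_compose[OF measurable_fst cm] by (simp add: case_prod_beta')
    then show ?thesis using im unfolding f_def case_prod_beta' by measurable
  qed
  note [measurable (raw)] = measurable_at3[OF fm]
  have i_section: "i \<omega> x \<in> borel_measurable borel" if [measurable]: "\<omega> \<in> space M" for \<omega> x
    by (rule measurable_at3[OF im, of "\<lambda>_. \<omega>" _ "\<lambda>_. x" "\<lambda>y. y"]) simp_all
  have f_section: "(\<lambda>y. f \<omega> x y) \<in> borel_measurable borel" if "\<omega> \<in> space M" for \<omega> x
    by (rule measurable_at3[OF fm, of "\<lambda>_. \<omega>" _ "\<lambda>_. x" "\<lambda>y. y"]) (simp_all add: that)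
  have f_section': "(\<lambda>x. f \<omega> x y) \<in> borel_measurable borel" if "\<omega> \<in> space M" for \<omega> y
    by (rule measurable_at3[OF fm, of "\<lambda>_. \<omega>" _ "\<lambda>x. x" "\<lambda>_. y"]) (simp_all add: that)
  have c_count: "c \<omega> x = emeasure (count_space UNIV) {y \<in> S \<omega>. R \<omega> x y}" if \<omega>: "\<omega> \<in> space M" for \<omega> x
  proof -
    have "c \<omega> x = (\<integral>\<^sup>+y. indicator {y. R \<omega> x y} y \<partial>\<mm> \<omega>)"
      unfolding c_def i_def by (intro nn_integral_cong) (simp add: indicator_def)
    also have "\<dots> = emeasure (count_space UNIV) {y \<in> S \<omega>. R \<omega> x y}"
      by (rule nn_integral_process_indicator[OF \<omega>])
        (rule measurable_at3[OF R, of "\<lambda>_. \<omega>" _ "\<lambda>_. x" "\<lambda>y. y"], simp_all add: \<omega>)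
    finally show ?thesis .
  qed
  have i_inv: "i (\<theta> z \<omega>) (z + x) (z + y) = i \<omega> x y" if "\<omega> \<in> space M" for \<omega> z x y
    by (simp add: i_def inv that)
  have c_inv: "c (\<theta> z \<omega>) (z + x) = c \<omega> x" if \<omega>: "\<omega> \<in> space M" for \<omega> z x
    unfolding c_def by (simp add: nn_integral_process_shift[OF \<omega> i_section[OF flow_closed[OF \<omega>]]] i_inv \<omega>)
  have f_inv: "f (\<theta> z \<omega>) (z + x) (z + y) = f \<omega> x y" if "\<omega> \<in> space M" for \<omega> z x y
    by (simp add: f_def i_inv c_inv that)
  have out: "(\<integral>\<^sup>+y. f \<omega> x y \<partial>\<mm> \<omega>) \<le> 1" if \<omega>: "\<omega> \<in> space M" for \<omega> x
  proof -
    have "(\<integral>\<^sup>+y. f \<omega> x y \<partial>\<mm> \<omega>) = c \<omega> x * inverse (c \<omega> x)"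
      unfolding f_def c_def by (rule nn_integral_multc) (rule measurable_process[OF \<omega> i_section[OF \<omega>]])
    also have "\<dots> \<le> 1"
      by (cases "c \<omega> x = 0"; cases "c \<omega> x = top") (auto simp: less_top simp flip: divide_ennreal_def)
    finally show ?thesis .
  qed
  have "AE \<omega> in M. \<forall>y\<in>S \<omega>. (\<integral>\<^sup>+x. f \<omega> x y \<partial>\<mm> \<omega>) < \<infinity>"
  proof (rule AE_all_windows)
    fix A :: "'x set"
    assume A: "A \<in> sets borel" "0 < emeasure \<nu> A" "emeasure \<nu> A < \<infinity>" "\<forall>x. - x \<in> A \<longleftrightarrow> x \<in> A"
    note [measurable] = A(1)
    define r where "r \<omega> = (\<integral>\<^sup>+y. \<integral>\<^sup>+x. indicator A y * f \<omega> x y \<partial>\<mm> \<omega> \<partial>\<mm> \<omega>)" for \<omega>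
    have "(\<integral>\<^sup>+\<omega>. r \<omega> \<partial>M) = (\<integral>\<^sup>+\<omega>. \<integral>\<^sup>+x. \<integral>\<^sup>+y. indicator A x * f \<omega> x y \<partial>\<mm> \<omega> \<partial>\<mm> \<omega> \<partial>M)"
      unfolding r_def by (rule mass_transport[OF fm f_inv A, symmetric])
    also have "\<dots> \<le> (\<integral>\<^sup>+\<omega>. emeasure (\<mm> \<omega>) A \<partial>M)"
    proof (rule nn_integral_mono)
      fix \<omega> assume \<omega>: "\<omega> \<in> space M"
      have "(\<integral>\<^sup>+x. \<integral>\<^sup>+y. indicator A x * f \<omega> x y \<partial>\<mm> \<omega> \<partial>\<mm> \<omega>) \<le> (\<integral>\<^sup>+x. indicator A x \<partial>\<mm> \<omega>)"
      proof (rule nn_integral_mono)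
        fix x
        have "(\<integral>\<^sup>+y. indicator A x * f \<omega> x y \<partial>\<mm> \<omega>) = indicator A x * (\<integral>\<^sup>+y. f \<omega> x y \<partial>\<mm> \<omega>)"
          by (rule nn_integral_cmult) (rule measurable_process[OF \<omega> f_section[OF \<omega>]])
        also have "\<dots> \<le> indicator A x * 1" using out[OF \<omega>] by (intro mult_left_mono) auto
        finally show "(\<integral>\<^sup>+y. indicator A x * f \<omega> x y \<partial>\<mm> \<omega>) \<le> indicator A x" by simp
      qed
      also have "\<dots> = emeasure (\<mm> \<omega>) A" using nn_integral_process_window[OF \<omega> A(1)] .
      finally show "(\<integral>\<^sup>+x. \<integral>\<^sup>+y. indicator A x * f \<omega> x y \<partial>\<mm> \<omega> \<partial>\<mm> \<omega>) \<le> emeasure (\<mm> \<omega>) A" .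
    qed
    also have "\<dots> < \<infinity>" by (rule mean_count_finite[OF A(1-3)])
    finally have fin: "(\<integral>\<^sup>+\<omega>. r \<omega> \<partial>M) \<noteq> \<infinity>" by simp
    have "r \<in> borel_measurable M"
      unfolding r_def
    proof (rule measurable_nn_integral_process)
      show "(\<lambda>(\<omega>, y). \<integral>\<^sup>+x. indicator A y * f \<omega> x y \<partial>\<mm> \<omega>) \<in> borel_measurable (M \<Otimes>\<^sub>M borel)"
        unfolding case_prod_beta' by measurable
    qed measurable
    then have "AE \<omega> in M. r \<omega> \<noteq> \<infinity>" using fin by (rule nn_integral_noteq_infinite)
    then show "AE \<omega> in M. \<forall>y\<in>S \<omega> \<inter> A. (\<integral>\<^sup>+x. f \<omega> x y \<partial>\<mm> \<omega>) < \<infinity>"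
    proof (rule AE_mp, intro AE_I2 impI ballI)
      fix \<omega> y assume \<omega> [measurable]: "\<omega> \<in> space M" and r: "r \<omega> \<noteq> \<infinity>" and y: "y \<in> S \<omega> \<inter> A"
      define G where "G y = (\<integral>\<^sup>+x. indicator A y * f \<omega> x y \<partial>\<mm> \<omega>)" for y
      have "(\<integral>\<^sup>+x. f \<omega> x y \<partial>\<mm> \<omega>) = G y" using y by (simp add: G_def)
      also have "\<dots> \<le> (\<integral>\<^sup>+y. G y \<partial>count_space (S \<omega>))" using y by (intro nn_integral_ge_point) simp
      also have "\<dots> = (\<integral>\<^sup>+y. G y \<partial>\<mm> \<omega>)"
      proof (rule nn_integral_process[OF \<omega>, symmetric])
        show "G \<in> borel_measurable borel" unfolding G_def
        proof (rule measurable_nn_integral_process[where W="\<lambda>_. \<omega>"])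
          show "(\<lambda>(y, x). indicator A y * f \<omega> x y) \<in> borel_measurable (borel \<Otimes>\<^sub>M borel)"
            unfolding case_prod_beta' by measurable
        qed measurable
      qed
      also have "\<dots> = r \<omega>" by (simp add: r_def G_def)
      also have "\<dots> < \<infinity>" using r by (simp add: less_top)
      finally show "(\<integral>\<^sup>+x. f \<omega> x y \<partial>\<mm> \<omega>) < \<infinity>" .
    qed
  qed
  then show ?thesis
  proof (rule AE_mp, intro AE_I2 impI allI)
    fix \<omega> and F :: "'x set"
    assume \<omega>: "\<omega> \<in> space M" and fin: "\<forall>y\<in>S \<omega>. (\<integral>\<^sup>+x. f \<omega> x y \<partial>\<mm> \<omega>) < \<infinity>" and F: "finite F" "F \<noteq> {}"
    define B where "B = {x \<in> S \<omega>. {y \<in> S \<omega>. R \<omega> x y} = F}"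
    show "finite B"
    proof (rule ccontr)
      assume inf: "infinite B"
      then obtain x0 where x0: "x0 \<in> B" using infinite_imp_nonempty by blast
      obtain y where yF: "y \<in> F" using F(2) by blast
      have y: "y \<in> S \<omega>" "\<And>x. x \<in> B \<Longrightarrow> R \<omega> x y" using yF x0 by (auto simp: B_def)
      have val: "f \<omega> x y = inverse (of_nat (card F))" if "x \<in> B" for x
      proof -
        have "{y \<in> S \<omega>. R \<omega> x y} = F" using that by (simp add: B_def)
        then have "c \<omega> x = of_nat (card F)" unfolding c_count[OF \<omega>] using F(1) by simp
        then show ?thesis using y(2)[OF that] by (simp add: f_def i_def)
      qed
      have "top = (\<integral>\<^sup>+x. inverse (of_nat (card F)) \<partial>count_space B)"
        using inf by (simp add: ennreal_mult_top ennreal_top_mult)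
      also have "\<dots> = (\<integral>\<^sup>+x. f \<omega> x y \<partial>count_space B)"
        by (intro nn_integral_cong) (simp add: val)
      also have "\<dots> \<le> (\<integral>\<^sup>+x. f \<omega> x y \<partial>count_space (S \<omega>))"
        by (subst (1 2) nn_integral_count_space_indicator)
          (auto intro!: nn_integral_mono simp: B_def indicator_def)
      also have "\<dots> = (\<integral>\<^sup>+x. f \<omega> x y \<partial>\<mm> \<omega>)"
        by (rule nn_integral_process[OF \<omega> f_section'[OF \<omega>], symmetric])
      also have "\<dots> < top" using fin y(1) by simp
      finally show False by simp
    qed
  qed
qed

lemma AE_self_map: "AE \<omega> in M. self_map (S \<omega>) (H \<omega>)"
  using shift_maps by (rule AE_mp) (auto intro!: AE_I2 self_map.intro)

lemma AE_finite_fibres: "AE \<omega> in M. \<forall>y\<in>S \<omega>. finite {x \<in> S \<omega>. H \<omega> x = y}"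
proof -
  have "Measurable.pred ((M \<Otimes>\<^sub>M borel) \<Otimes>\<^sub>M borel) (\<lambda>((\<omega>, x), y). (H \<omega> ^^ 1) x = y)"
    unfolding case_prod_beta' by measurable
  then have "AE \<omega> in M. \<forall>F. finite F \<longrightarrow> F \<noteq> {} \<longrightarrow> finite {x \<in> S \<omega>. {y \<in> S \<omega>. (H \<omega> ^^ 1) x = y} = F}"
    by (rule finitely_many_sources) (simp add: shift_flow)
  then show ?thesis
  proof (rule AE_mp, intro AE_I2 impI ballI)
    fix \<omega> y assume *: "\<forall>F. finite F \<longrightarrow> F \<noteq> {} \<longrightarrow> finite {x \<in> S \<omega>. {y \<in> S \<omega>. (H \<omega> ^^ 1) x = y} = F}"
      and y: "y \<in> S \<omega>"
    have "finite {x \<in> S \<omega>. {y \<in> S \<omega>. (H \<omega> ^^ 1) x = y} = {y}}" using * by blast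
    moreover have "{x \<in> S \<omega>. H \<omega> x = y} \<subseteq> {x \<in> S \<omega>. {y \<in> S \<omega>. (H \<omega> ^^ 1) x = y} = {y}}"
      using y by auto
    ultimately show "finite {x \<in> S \<omega>. H \<omega> x = y}" by (rule finite_subset[rotated])
  qed
qed

text \<open>
  The \<open>Q\<close>-points of the component of \<open>x\<close> depend only on the component, so all its points select the
  same set. The type of \<open>N\<close> is that of the triples \<open>((\<omega>, x), y)\<close> on which the selection is measured.
\<close>
lemma AE_no_finite_selection:
  assumes Q: "\<And>N :: (('w \<times> 'x) \<times> 'x) measure. \<And>W X. W \<in> N \<rightarrow>\<^sub>M M \<Longrightarrow> X \<in> N \<rightarrow>\<^sub>M borel \<Longrightarrow> Measurable.pred N (\<lambda>n. Q (W n) (X n))"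
    and inv: "\<And>\<omega> z x. \<omega> \<in> space M \<Longrightarrow> Q (\<theta> z \<omega>) (z + x) \<longleftrightarrow> Q \<omega> x"
  shows "AE \<omega> in M. no_finite_selection (S \<omega>) (H \<omega>) (Q \<omega>)"
proof -
  note [measurable (raw)] = Q
  have "Measurable.pred ((M \<Otimes>\<^sub>M borel) \<Otimes>\<^sub>M borel)
      (\<lambda>((\<omega>, x), y). (x, y) \<in> connected_rel (S \<omega>) (H \<omega>) \<and> Q \<omega> y)"
    unfolding case_prod_beta' by measurable
  then have "AE \<omega> in M. \<forall>F. finite F \<longrightarrow> F \<noteq> {} \<longrightarrow>
      finite {x \<in> S \<omega>. {y \<in> S \<omega>. (x, y) \<in> connected_rel (S \<omega>) (H \<omega>) \<and> Q \<omega> y} = F}"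
    by (rule finitely_many_sources) (simp add: connected_shift inv)
  with AE_self_map show ?thesis
  proof eventually_elim
    case (elim \<omega>)
    interpret self_map "S \<omega>" "H \<omega>" by fact
    show ?case unfolding no_finite_selection_def
    proof (intro ballI impI)
      fix x assume x: "x \<in> S \<omega>" "infinite (conn `` {x})"
      define F where "F = {y \<in> conn `` {x}. Q \<omega> y}"
      have "{y \<in> S \<omega>. (x', y) \<in> conn \<and> Q \<omega> y} = F" if "(x, x') \<in> conn" for x'
      proof (intro equalityI subsetI)
        fix y assume "y \<in> {y \<in> S \<omega>. (x', y) \<in> conn \<and> Q \<omega> y}"
        then have "(x', y) \<in> conn" "Q \<omega> y" by blast+
        then show "y \<in> F" using conn_trans[OF that] by (simp add: F_def)
      next
        fix y assume "y \<in> F"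
        then have "(x, y) \<in> conn" "Q \<omega> y" by (simp_all add: F_def)
        moreover from this have "y \<in> S \<omega>" by (simp add: connected_rel_def)
        ultimately show "y \<in> {y \<in> S \<omega>. (x', y) \<in> conn \<and> Q \<omega> y}"
          using conn_trans[OF conn_sym[OF that]] by simp
      qed
      moreover have "x' \<in> S \<omega>" if "(x, x') \<in> conn" for x' using that by (simp add: connected_rel_def)
      ultimately have "conn `` {x} \<subseteq> {x' \<in> S \<omega>. {y \<in> S \<omega>. (x', y) \<in> conn \<and> Q \<omega> y} = F}" by blast
      then have "infinite {x' \<in> S \<omega>. {y \<in> S \<omega>. (x', y) \<in> conn \<and> Q \<omega> y} = F}"
        using x(2) finite_subset by blast
      then show "{y \<in> conn `` {x}. Q \<omega> y} = {} \<or> infinite {y \<in> conn `` {x}. Q \<omega> y}"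
        using elim(2) unfolding F_def[symmetric] by blast
    qed
  qed
qed

text \<open>
  Every primeval point sends mass \<open>1\<close> to its image, which is primeval. The mass received by a
  primeval point is the number \<open>d\<close> of its primeval preimages, which is at least \<open>1\<close> by
  \<open>primeval_surj\<close>. As the means over a window agree and are finite, the excess \<open>d - 1\<close> vanishes.
\<close>
theorem AE_inj_primeval: "AE \<omega> in M. inj_on (H \<omega>) (primeval (S \<omega>) (H \<omega>))"
proof -
  \<comment> \<open>local facts are monomorphic, so measurability of \<open>P\<close> is stated for each of the spaces it occurs on\<close>
  define P where "P \<omega> = primeval (S \<omega>) (H \<omega>)" for \<omega>
  define f where "f \<omega> x y = (indicator {x. x \<in> P \<omega> \<and> y \<in> P \<omega> \<and> (H \<omega> ^^ 1) x = y} x :: ennreal)" for \<omega> x y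
  \<comment> \<open>the exponent \<open>1\<close> makes the measurability rule for iterates of the point-shift applicable\<close>
  define d where "d \<omega> y = emeasure (count_space UNIV) {x \<in> S \<omega>. x \<in> P \<omega> \<and> y \<in> P \<omega> \<and> (H \<omega> ^^ 1) x = y}" for \<omega> y
  have [measurable (raw)]: "Measurable.pred N (\<lambda>n. X n \<in> P (W n))"
    if "W \<in> N \<rightarrow>\<^sub>M M" "X \<in> N \<rightarrow>\<^sub>M borel" for N :: "(('w \<times> 'x) \<times> 'x) measure" and W X
    unfolding P_def using that by (rule pred_primeval)
  have [measurable (raw)]: "Measurable.pred N (\<lambda>n. X n \<in> P (W n))"
    if "W \<in> N \<rightarrow>\<^sub>M M" "X \<in> N \<rightarrow>\<^sub>M borel" for N :: "('w \<times> 'x) measure" and W X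
    unfolding P_def using that by (rule pred_primeval)
  have [measurable (raw)]: "Measurable.pred N (\<lambda>n. X n \<in> P (W n))"
    if "W \<in> N \<rightarrow>\<^sub>M M" "X \<in> N \<rightarrow>\<^sub>M borel" for N :: "'x measure" and W X
    unfolding P_def using that by (rule pred_primeval)
  have fm: "(\<lambda>((\<omega>, x), y). f \<omega> x y) \<in> borel_measurable ((M \<Otimes>\<^sub>M borel) \<Otimes>\<^sub>M borel)"
  proof -
    have [measurable]: "Measurable.pred ((M \<Otimes>\<^sub>M borel) \<Otimes>\<^sub>M borel) (\<lambda>((\<omega>, x), y). x \<in> P \<omega> \<and> y \<in> P \<omega> \<and> (H \<omega> ^^ 1) x = y)"
      unfolding case_prod_beta' by measurable
    have "(\<lambda>p. indicator {((\<omega>, x), y). x \<in> P \<omega> \<and> y \<in> P \<omega> \<and> (H \<omega> ^^ 1) x = y} p :: ennreal)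
        \<in> borel_measurable ((M \<Otimes>\<^sub>M borel) \<Otimes>\<^sub>M borel)"
      by measurable
    then show ?thesis
      by (rule back_subst[where P="\<lambda>f. f \<in> _"]) (auto simp: fun_eq_iff f_def indicator_def)
  qed
  have f_inv: "f (\<theta> z \<omega>) (z + x) (z + y) = f \<omega> x y" if "\<omega> \<in> space M" for \<omega> z x y
    using that by (simp add: f_def indicator_def P_def primeval_shift shift_flow)
  have dm: "(\<lambda>(\<omega>, y). d \<omega> y) \<in> borel_measurable (M \<Otimes>\<^sub>M borel)"
    unfolding d_def case_prod_beta'
  proof (rule measurable_count_atoms)
    show "(\<lambda>(n, x). x \<in> P (fst n) \<and> snd n \<in> P (fst n) \<and> (H (fst n) ^^ 1) x = snd n)
        \<in> (M \<Otimes>\<^sub>M borel) \<Otimes>\<^sub>M borel \<rightarrow>\<^sub>M count_space UNIV"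
      unfolding case_prod_beta' by measurable
  qed measurable
  have in_f: "(\<integral>\<^sup>+x. f \<omega> x y \<partial>\<mm> \<omega>) = d \<omega> y" if \<omega> [measurable]: "\<omega> \<in> space M" for \<omega> y
    unfolding f_def d_def by (rule nn_integral_process_indicator[OF \<omega>]) measurable
  have out_f: "(\<integral>\<^sup>+y. f \<omega> x y \<partial>\<mm> \<omega>) = indicator (P \<omega>) x"
    if \<omega> [measurable]: "\<omega> \<in> space M" and "self_map (S \<omega>) (H \<omega>)" for \<omega> x
  proof -
    interpret self_map "S \<omega>" "H \<omega>" by fact
    have "(\<integral>\<^sup>+y. f \<omega> x y \<partial>\<mm> \<omega>) = (\<integral>\<^sup>+y. indicator {y. x \<in> P \<omega> \<and> y \<in> P \<omega> \<and> (H \<omega> ^^ 1) x = y} y \<partial>\<mm> \<omega>)"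
      by (intro nn_integral_cong) (auto simp: f_def indicator_def)
    also have "\<dots> = emeasure (count_space UNIV) {y \<in> S \<omega>. x \<in> P \<omega> \<and> y \<in> P \<omega> \<and> (H \<omega> ^^ 1) x = y}"
      by (rule nn_integral_process_indicator[OF \<omega>]) measurable
    also have "{y \<in> S \<omega>. x \<in> P \<omega> \<and> y \<in> P \<omega> \<and> (H \<omega> ^^ 1) x = y} = (if x \<in> P \<omega> then {H \<omega> x} else {})"
      using primeval_closed[of x] by (auto simp: P_def primeval_def)
    finally show ?thesis by (simp add: indicator_def)
  qed
  have "AE \<omega> in M. \<forall>y\<in>S \<omega>. y \<in> P \<omega> \<longrightarrow> d \<omega> y \<le> 1"
  proof (rule AE_all_windows)
    fix A :: "'x set"
    assume A: "A \<in> sets borel" "0 < emeasure \<nu> A" "emeasure \<nu> A < \<infinity>" "\<forall>x. - x \<in> A \<longleftrightarrow> x \<in> A"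
    note [measurable] = A(1)
    define a where "a \<omega> y = (indicator {y. y \<in> A \<and> y \<in> P \<omega>} y :: ennreal)" for \<omega> y
    \<comment> \<open>the excess over one preimage, so that received mass is \<open>a + e\<close>\<close>
    define e where "e \<omega> y = a \<omega> y * (d \<omega> y - 1)" for \<omega> y
    have am: "(\<lambda>(\<omega>, y). a \<omega> y) \<in> borel_measurable (M \<Otimes>\<^sub>M borel)"
    proof -
      have [measurable]: "Measurable.pred (M \<Otimes>\<^sub>M borel) (\<lambda>(\<omega>, y). y \<in> A \<and> y \<in> P \<omega>)"
        unfolding case_prod_beta' by measurable
      have "(\<lambda>p. indicator {(\<omega>, y). y \<in> A \<and> y \<in> P \<omega>} p :: ennreal) \<in> borel_measurable (M \<Otimes>\<^sub>M borel)"
        by measurable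
      then show ?thesis
        by (rule back_subst[where P="\<lambda>f. f \<in> _"]) (auto simp: fun_eq_iff a_def indicator_def)
    qed
    have em: "(\<lambda>(\<omega>, y). e \<omega> y) \<in> borel_measurable (M \<Otimes>\<^sub>M borel)"
      using am dm unfolding e_def case_prod_beta' by measurable
    have am1: "a \<omega> \<in> borel_measurable borel" and em1: "e \<omega> \<in> borel_measurable borel" if "\<omega> \<in> space M" for \<omega>
      using measurable_compose[OF measurable_Pair1'[OF that] am] measurable_compose[OF measurable_Pair1'[OF that] em] by simp_all
    have aI: "(\<lambda>\<omega>. \<integral>\<^sup>+y. a \<omega> y \<partial>\<mm> \<omega>) \<in> borel_measurable M" and eI: "(\<lambda>\<omega>. \<integral>\<^sup>+y. e \<omega> y \<partial>\<mm> \<omega>) \<in> borel_measurable M"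
      using measurable_nn_integral_process[OF measurable_ident am] measurable_nn_integral_process[OF measurable_ident em]
      by (simp_all add: id_def)
    have "(\<integral>\<^sup>+\<omega>. \<integral>\<^sup>+y. a \<omega> y \<partial>\<mm> \<omega> \<partial>M) = (\<integral>\<^sup>+\<omega>. \<integral>\<^sup>+x. \<integral>\<^sup>+y. indicator A x * f \<omega> x y \<partial>\<mm> \<omega> \<partial>\<mm> \<omega> \<partial>M)"
    proof (rule nn_integral_cong_AE, rule AE_mp[OF AE_self_map], intro AE_I2 impI)
      fix \<omega> assume \<omega>: "\<omega> \<in> space M" "self_map (S \<omega>) (H \<omega>)"
      show "(\<integral>\<^sup>+y. a \<omega> y \<partial>\<mm> \<omega>) = (\<integral>\<^sup>+x. \<integral>\<^sup>+y. indicator A x * f \<omega> x y \<partial>\<mm> \<omega> \<partial>\<mm> \<omega>)"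
      proof (rule nn_integral_cong)
        fix x
        have "(\<lambda>y. f \<omega> x y) \<in> borel_measurable borel"
          by (rule measurable_at3[OF fm, of "\<lambda>_. \<omega>" _ "\<lambda>_. x" "\<lambda>y. y"]) (simp_all add: \<omega>)
        then have "(\<integral>\<^sup>+y. indicator A x * f \<omega> x y \<partial>\<mm> \<omega>) = indicator A x * (\<integral>\<^sup>+y. f \<omega> x y \<partial>\<mm> \<omega>)"
          by (intro nn_integral_cmult measurable_process[OF \<omega>(1)])
        then show "a \<omega> x = (\<integral>\<^sup>+y. indicator A x * f \<omega> x y \<partial>\<mm> \<omega>)"
          unfolding out_f[OF \<omega>] by (simp add: a_def indicator_def)
      qed
    qed
    also have "\<dots> = (\<integral>\<^sup>+\<omega>. \<integral>\<^sup>+y. \<integral>\<^sup>+x. indicator A y * f \<omega> x y \<partial>\<mm> \<omega> \<partial>\<mm> \<omega> \<partial>M)"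
      by (rule mass_transport[OF fm f_inv A])
    also have "\<dots> = (\<integral>\<^sup>+\<omega>. (\<integral>\<^sup>+y. a \<omega> y \<partial>\<mm> \<omega>) + (\<integral>\<^sup>+y. e \<omega> y \<partial>\<mm> \<omega>) \<partial>M)"
    proof (rule nn_integral_cong_AE, rule AE_mp[OF AE_self_map], rule AE_mp[OF AE_finite_fibres], intro AE_I2 impI)
      fix \<omega> assume \<omega>: "\<omega> \<in> space M" and fib: "\<forall>y\<in>S \<omega>. finite {x \<in> S \<omega>. H \<omega> x = y}" and "self_map (S \<omega>) (H \<omega>)"
      interpret self_map "S \<omega>" "H \<omega>" by fact
      have d1: "1 \<le> d \<omega> y" if "y \<in> P \<omega>" for y
      proof -
        have "\<exists>x\<in>primeval (S \<omega>) (H \<omega>). H \<omega> x = y"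
          using fib that unfolding P_def by (intro primeval_surj) auto
        then obtain x where x: "x \<in> P \<omega>" "H \<omega> x = y" unfolding P_def by blast
        then have "{x} \<subseteq> {x \<in> S \<omega>. x \<in> P \<omega> \<and> y \<in> P \<omega> \<and> (H \<omega> ^^ 1) x = y}"
          using that by (auto simp: P_def primeval_def)
        then have "emeasure (count_space UNIV) {x} \<le> d \<omega> y" unfolding d_def by (intro emeasure_mono) auto
        then show ?thesis by simp
      qed
      have "(\<integral>\<^sup>+y. \<integral>\<^sup>+x. indicator A y * f \<omega> x y \<partial>\<mm> \<omega> \<partial>\<mm> \<omega>) = (\<integral>\<^sup>+y. a \<omega> y + e \<omega> y \<partial>\<mm> \<omega>)"
      proof (rule nn_integral_cong)
        fix y
        have "(\<lambda>x. f \<omega> x y) \<in> borel_measurable borel"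
          by (rule measurable_at3[OF fm, of "\<lambda>_. \<omega>" _ "\<lambda>x. x" "\<lambda>_. y"]) (simp_all add: \<omega>)
        then have "(\<integral>\<^sup>+x. indicator A y * f \<omega> x y \<partial>\<mm> \<omega>) = indicator A y * d \<omega> y"
          by (simp add: nn_integral_cmult measurable_process[OF \<omega>] in_f[OF \<omega>])
        also have "\<dots> = a \<omega> y + e \<omega> y"
        proof (cases "y \<in> P \<omega>")
          case True
          then show ?thesis using d1[OF True]
            by (cases "y \<in> A") (simp_all add: a_def e_def add_diff_inverse_ennreal)
        next
          case False
          then have "{x \<in> S \<omega>. x \<in> P \<omega> \<and> y \<in> P \<omega> \<and> (H \<omega> ^^ 1) x = y} = {}" by blast
          then have "d \<omega> y = 0" unfolding d_def by (simp only: emeasure_empty)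
          then show ?thesis using False by (simp add: a_def e_def)
        qed
        finally show "(\<integral>\<^sup>+x. indicator A y * f \<omega> x y \<partial>\<mm> \<omega>) = a \<omega> y + e \<omega> y" .
      qed
      also have "\<dots> = (\<integral>\<^sup>+y. a \<omega> y \<partial>\<mm> \<omega>) + (\<integral>\<^sup>+y. e \<omega> y \<partial>\<mm> \<omega>)"
        by (intro nn_integral_add measurable_process[OF \<omega>] am1 em1 \<omega>)
      finally show "(\<integral>\<^sup>+y. \<integral>\<^sup>+x. indicator A y * f \<omega> x y \<partial>\<mm> \<omega> \<partial>\<mm> \<omega>) = (\<integral>\<^sup>+y. a \<omega> y \<partial>\<mm> \<omega>) + (\<integral>\<^sup>+y. e \<omega> y \<partial>\<mm> \<omega>)" .
    qed
    also have "\<dots> = (\<integral>\<^sup>+\<omega>. \<integral>\<^sup>+y. a \<omega> y \<partial>\<mm> \<omega> \<partial>M) + (\<integral>\<^sup>+\<omega>. \<integral>\<^sup>+y. e \<omega> y \<partial>\<mm> \<omega> \<partial>M)"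
      by (rule nn_integral_add[OF aI eI])
    finally have sum: "(\<integral>\<^sup>+\<omega>. \<integral>\<^sup>+y. a \<omega> y \<partial>\<mm> \<omega> \<partial>M) + 0 = (\<integral>\<^sup>+\<omega>. \<integral>\<^sup>+y. a \<omega> y \<partial>\<mm> \<omega> \<partial>M) + (\<integral>\<^sup>+\<omega>. \<integral>\<^sup>+y. e \<omega> y \<partial>\<mm> \<omega> \<partial>M)"
      by simp
    have "(\<integral>\<^sup>+\<omega>. \<integral>\<^sup>+y. a \<omega> y \<partial>\<mm> \<omega> \<partial>M) \<le> (\<integral>\<^sup>+\<omega>. emeasure (\<mm> \<omega>) A \<partial>M)"
    proof (rule nn_integral_mono)
      fix \<omega> assume \<omega>: "\<omega> \<in> space M"
      have "(\<integral>\<^sup>+y. a \<omega> y \<partial>\<mm> \<omega>) \<le> (\<integral>\<^sup>+y. indicator A y \<partial>\<mm> \<omega>)"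
        by (intro nn_integral_mono) (simp add: a_def indicator_def)
      then show "(\<integral>\<^sup>+y. a \<omega> y \<partial>\<mm> \<omega>) \<le> emeasure (\<mm> \<omega>) A"
        by (simp only: nn_integral_process_window[OF \<omega> A(1)])
    qed
    also have "\<dots> < \<infinity>" by (rule mean_count_finite[OF A(1-3)])
    finally have "(\<integral>\<^sup>+\<omega>. \<integral>\<^sup>+y. e \<omega> y \<partial>\<mm> \<omega> \<partial>M) = 0"
      using sum by (metis ennreal_add_left_cancel infinity_ennreal_def less_irrefl)
    then have "AE \<omega> in M. (\<integral>\<^sup>+y. e \<omega> y \<partial>\<mm> \<omega>) = 0"
      using nn_integral_0_iff_AE[OF eI] by simp
    then show "AE \<omega> in M. \<forall>y\<in>S \<omega> \<inter> A. y \<in> P \<omega> \<longrightarrow> d \<omega> y \<le> 1"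
    proof (rule AE_mp, intro AE_I2 impI ballI)
      fix \<omega> y assume \<omega>: "\<omega> \<in> space M" and e0: "(\<integral>\<^sup>+y. e \<omega> y \<partial>\<mm> \<omega>) = 0" and y: "y \<in> S \<omega> \<inter> A" "y \<in> P \<omega>"
      have "e \<omega> y \<le> (\<integral>\<^sup>+y. e \<omega> y \<partial>count_space (S \<omega>))" using y by (intro nn_integral_ge_point) simp
      also have "\<dots> = 0" using nn_integral_process[OF \<omega> em1[OF \<omega>]] e0 by simp
      finally have "d \<omega> y - 1 = 0" using y by (simp add: e_def a_def)
      then show "d \<omega> y \<le> 1" by (simp add: diff_eq_0_iff_ennreal)
    qed
  qed
  with AE_self_map show ?thesis
  proof eventually_elim
    case (elim \<omega>)
    interpret self_map "S \<omega>" "H \<omega>" by fact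
    show ?case
    proof (rule inj_onI)
      fix x x' assume x: "x \<in> primeval (S \<omega>) (H \<omega>)" "x' \<in> primeval (S \<omega>) (H \<omega>)" "H \<omega> x = H \<omega> x'"
      define y where "y = H \<omega> x"
      have y: "y \<in> P \<omega>" "y \<in> S \<omega>" using primeval_closed[OF x(1)] by (auto simp: y_def P_def primeval_def)
      have "{x, x'} \<subseteq> {x \<in> S \<omega>. x \<in> P \<omega> \<and> y \<in> P \<omega> \<and> (H \<omega> ^^ 1) x = y}"
        using x y by (auto simp: y_def P_def primeval_def)
      then have "emeasure (count_space UNIV) {x, x'} \<le> d \<omega> y" unfolding d_def by (intro emeasure_mono) auto
      also have "\<dots> \<le> 1" using elim(2) y by blast
      finally have "(of_nat (card {x, x'}) :: ennreal) \<le> of_nat 1" by simp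
      then have "card {x, x'} \<le> 1" unfolding of_nat_le_iff .
      then show "x = x'" by (cases "x = x'") auto
    qed
  qed
qed

text \<open>
  By injectivity a foil contains at most one primeval point, so all points of the foil select
  this one point.
\<close>
theorem AE_primeval_foil_finite:
  "AE \<omega> in M. \<forall>y\<in>primeval (S \<omega>) (H \<omega>). finite (foil_rel (S \<omega>) (H \<omega>) `` {y})"
proof -
  have "Measurable.pred ((M \<Otimes>\<^sub>M borel) \<Otimes>\<^sub>M borel)
      (\<lambda>((\<omega>, x), y). (x, y) \<in> foil_rel (S \<omega>) (H \<omega>) \<and> y \<in> primeval (S \<omega>) (H \<omega>))"
    unfolding case_prod_beta' by measurable
  then have "AE \<omega> in M. \<forall>F. finite F \<longrightarrow> F \<noteq> {} \<longrightarrow>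
      finite {x \<in> S \<omega>. {y \<in> S \<omega>. (x, y) \<in> foil_rel (S \<omega>) (H \<omega>) \<and> y \<in> primeval (S \<omega>) (H \<omega>)} = F}"
    by (rule finitely_many_sources) (simp add: foil_shift primeval_shift)
  with AE_self_map AE_inj_primeval show ?thesis
  proof eventually_elim
    case (elim \<omega>)
    interpret self_map "S \<omega>" "H \<omega>" by fact
    show ?case
    proof
      fix y assume y: "y \<in> primeval (S \<omega>) (H \<omega>)"
      have "{y' \<in> S \<omega>. (x, y') \<in> foil \<and> y' \<in> primeval (S \<omega>) (H \<omega>)} = {y}" if "(y, x) \<in> foil" for x
      proof -
        have "y' = y" if "(x, y') \<in> foil" "y' \<in> primeval (S \<omega>) (H \<omega>)" for y'
          using primeval_foil_unique[OF elim(2) that(2) y] foil_trans[OF \<open>(y, x) \<in> foil\<close> that(1)] foil_sym by blast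
        moreover have "y \<in> S \<omega>" using y by (simp add: primeval_def)
        ultimately show ?thesis using y that foil_sym by blast
      qed
      then have "foil `` {y} \<subseteq> {x \<in> S \<omega>. {y' \<in> S \<omega>. (x, y') \<in> foil \<and> y' \<in> primeval (S \<omega>) (H \<omega>)} = {y}}"
        by (auto simp: foil_rel_def)
      moreover have "finite {x \<in> S \<omega>. {y' \<in> S \<omega>. (x, y') \<in> foil \<and> y' \<in> primeval (S \<omega>) (H \<omega>)} = {y}}"
        using elim(3) by blast
      ultimately show "finite (foil `` {y})" by (rule finite_subset)
    qed
  qed
qed

end

section \<open>The classification theorem\<close>

theorem theorem3p12:
  fixes M :: "'w measure"
    and \<theta> :: "'x :: {topological_group_add, second_countable_topology, t2_space} \<Rightarrow> 'w \<Rightarrow> 'w"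
    and \<nu> :: "'x measure"
    and \<mm> :: "'w \<Rightarrow> 'x measure"
    and H :: "'w \<Rightarrow> 'x \<Rightarrow> 'x"
    and \<gamma> :: ennreal
  assumes "locally_compact_space (euclidean :: 'x topology)"
    and "left_haar_measure \<nu>"
    and unimodular: "right_invariant \<nu>"
    and "point_shift M \<theta> \<mm> H"
    and "has_intensity M \<nu> \<mm> \<gamma>" and "0 < \<gamma>" and "\<gamma> < \<infinity>"
  shows "AE \<omega> in M. \<forall>C\<in>graph_components (shift_graph (atoms (\<mm> \<omega>)) (H \<omega>)).
    (let S = atoms (\<mm> \<omega>); h = H \<omega>; G = shift_graph S h in
      (class_FF S h C \<or> class_IF S h C \<or> class_II S h C) \<and>
      (class_FF S h C \<longrightarrow>
        finite (foils_in S h C) \<and> 1 \<le> card (foils_in S h C) \<and>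
        (\<exists>p. cycle_in G C p \<and> (\<forall>q. cycle_in G C q \<longrightarrow> (\<exists>k. q = rotate k p)) \<and>
             length p = card (foils_in S h C) \<and>
             primeval S h \<inter> C = tail G ` set p)) \<and>
      (class_IF S h C \<longrightarrow>
        acyclic_on G C \<and>
        (\<forall>L\<in>foils_in S h C. has_junior_foil S h L) \<and>
        (\<exists>X. bi_infinite_path S h X \<and> range X = primeval S h \<inter> C \<and>
             (\<forall>Y. bi_infinite_path S h Y \<and> range Y \<subseteq> C \<longrightarrow> (\<exists>k. \<forall>n. Y n = X (n + k))))) \<and>
      (class_II S h C \<longrightarrow>
        acyclic_on G C \<and> primeval S h \<inter> C = {}))"
proof -
  interpret point_shift M \<theta> \<mm> H by fact
  interpret unimodular_point_shift M \<theta> \<mm> H \<nu> \<gamma>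
    by unfold_locales (use assms in auto)
  have last: "AE \<omega> in M. no_finite_selection (S \<omega>) (H \<omega>) (last_finite (S \<omega>) (H \<omega>))"
    by (rule AE_no_finite_selection) (rule pred_last_finite last_finite_shift; assumption)+
  have bottom: "AE \<omega> in M. no_finite_selection (S \<omega>) (H \<omega>) (fruitless (S \<omega>) (H \<omega>))"
    by (rule AE_no_finite_selection) (rule pred_fruitless fruitless_shift; assumption)+
  from AE_self_map AE_finite_fibres AE_inj_primeval AE_primeval_foil_finite last bottom
  show ?thesis
  proof eventually_elim
    case (elim \<omega>)
    have fibres: "finite {x \<in> S \<omega>. H \<omega> x = y}" if "y \<in> S \<omega>" for y using elim(2) that by (rule bspec)
    have foils: "finite (foil_rel (S \<omega>) (H \<omega>) `` {y})" if "y \<in> primeval (S \<omega>) (H \<omega>)" for y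
      using elim(4) that by (rule bspec)
    show ?case
      unfolding Let_def
      by (rule ballI, rule self_map.classification[OF elim(1) _ elim(5,6,3)], erule fibres, erule foils, assumption)
  qed
qed

end
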